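(* Let $\mathcal{U}\subseteq\mathbb{C}$ be an open set (not necessarily connected) which is symmetric with respect to the real axis and such that $\mathcal{U}\cap\mathbb{R}$ consists of a segment of the real axis. Let $f:\mathcal{U}\to\mathbb{C}$ be a Krein-operator convex function on $\mathcal{U}$ with $f(0)=0$. Then \[ f(C^{\sharp}AC)\leq^{J}C^{\sharp}f(A)C \] for every Krein space $(\mathscr{H},J)$, all $J$-positive operators $A\in\mathbb{B}(\mathscr{H})$ and all invertible $J$-contractions $C\in\mathbb{B}(\mathscr{H})$ such that the spectra of $A$, $C^{\sharp}AC$ and $D^{\sharp}AD$ are contained in $\mathcal{U}$, where $D$ is a defect operator for $C^{\sharp}$.
   Context: A Krein space $(\mathscr{H},J)$ is a Hilbert space $(\mathscr{H},\langle\cdot,\cdot\rangle)$ together with a nontrivial selfadjoint involution $J$ ($J=J^*=J^{-1}$), giving the indefinite inner product $[x,y]_J=\langle Jx,y\rangle$. For Krein spaces $(\mathscr{H}_1,J_1)$, $(\mathscr{H}_2,J_2)$ and $T\in\mathbb{B}(\mathscr{H}_1,\mathscr{H}_2)$, the adjoint $T^{\sharp}=J_1T^*J_2$ is defined by $[Tx,y]_{J_2}=[x,T^\sharp y]_{J_1}$. An operator $A\in\mathbb{B}(\mathscr{H})$ is $J$-selfadjoint if $A^\sharp=A$. For $J$-selfadjoint $A,B$, $A\leq^J B$ means $[Ax,x]_J\le[Bx,x]_J$ for all $x$, i.e. $JA\le JB$; $A$ is $J$-positive if $0\leq^J A$. $C\in\mathbb{B}(\mathscr{H})$ is a $J$-contraction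 if $C^\sharp C\leq^J I$, i.e. $C^*JC\le J$. A defect operator for an operator $T\in\mathbb{B}(\mathscr{H}_1,\mathscr{H}_2)$ is any operator $E\in\mathbb{B}(\tilde{\mathscr{H}},\mathscr{H}_1)$, where $(\tilde{\mathscr{H}},\tilde J)$ is some Krein space, such that $E$ has zero kernel and $I_{\mathscr{H}_1}-T^\sharp T=EE^\sharp$; thus a defect operator $D$ for $C^\sharp$ satisfies $I_{\mathscr{H}}-CC^\sharp=DD^\sharp$ (here the auxiliary space may be a Hilbert space, i.e. $\tilde J=I$). For an operator $T$ with $\sigma(T)\subseteq\mathcal{U}$ and $f$ analytic on $\mathcal{U}$, $f(T)=\frac{1}{2\pi i}\int_\Gamma f(\lambda)(\lambda I-T)^{-1}d\lambda$ (Dunford–Riesz calculus, $\Gamma$ a suitable finite family of positively oriented closed rectifiable contours surrounding $\sigma(T)$ in $\mathcal{U}$). Definition: an analytic function $f:\mathcal{U}\to\mathbb{C}$ with $f(x)\in\mathbb{R}$ for all $x\in\mathcal{U}\cap\mathbb{R}$ is Krein-operator convex if $f((1-\lambda)A+\lambda B)\leq^J(1-\lambda)f(A)+\lambda f(B)$ for all $\lambda\in[0,1]$ and all $J$-positive operators $A,B$ on any Krein space $(\mathscr{H},J)$ such that the spectra of $A$, $B$ and $(1-\lambda)A+\lambda B$ are contained in $\mathcal{U}$. *)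

theory Defs
  imports "HOL-Complex_Analysis.Complex_Analysis"
begin

class complex_inner = real_normed_vector +
  fixes scaleC :: "complex \<Rightarrow> 'a \<Rightarrow> 'a" (infixr \<open>*\<^sub>C\<close> 75)
    and cinner :: "'a \<Rightarrow> 'a \<Rightarrow> complex"
  assumes scaleC_add_right: "c *\<^sub>C (x + y) = c *\<^sub>C x + c *\<^sub>C y"
    and scaleC_add_left: "(c + d) *\<^sub>C x = c *\<^sub>C x + d *\<^sub>C x"
    and scaleC_scaleC: "c *\<^sub>C (d *\<^sub>C x) = (c * d) *\<^sub>C x"
    and scaleC_one: "1 *\<^sub>C x = x"
    and scaleR_scaleC: "scaleR r x = complex_of_real r *\<^sub>C x"
    and cinner_add_left: "cinner (x + y) z = cinner x z + cinner y z"
    and cinner_scaleC_left: "cinner (c *\<^sub>C x) y = c * cinner x y"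
    and cinner_commute: "cinner y x = cnj (cinner x y)"
    and norm_eq_cinner: "norm x = sqrt (Re (cinner x x))"
    and cinner_self_nonneg: "0 \<le> Re (cinner x x)"

class chilbert = complex_inner + complete_space

instantiation prod :: (complex_inner, complex_inner) complex_inner
begin
definition scaleC_prod_def: "c *\<^sub>C x = (c *\<^sub>C fst x, c *\<^sub>C snd x)"
definition cinner_prod_def: "cinner x y = cinner (fst x) (fst y) + cinner (snd x) (snd y)"
instance
proof
  fix c d :: complex and x y z :: "'a \<times> 'b" and r :: real
  show "c *\<^sub>C (x + y) = c *\<^sub>C x + c *\<^sub>C y"
    by (simp add: scaleC_prod_def scaleC_add_right)
  show "(c + d) *\<^sub>C x = c *\<^sub>C x + d *\<^sub>C x"
    by (simp add: scaleC_prod_def scaleC_add_left)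
  show "c *\<^sub>C (d *\<^sub>C x) = (c * d) *\<^sub>C x"
    by (simp add: scaleC_prod_def scaleC_scaleC)
  show "1 *\<^sub>C x = x"
    by (simp add: scaleC_prod_def scaleC_one)
  show "scaleR r x = complex_of_real r *\<^sub>C x"
    by (simp add: scaleC_prod_def scaleR_scaleC scaleR_prod_def)
  show "cinner (x + y) z = cinner x z + cinner y z"
    by (simp add: cinner_prod_def cinner_add_left)
  show "cinner (c *\<^sub>C x) y = c * cinner x y"
    by (simp add: cinner_prod_def cinner_scaleC_left scaleC_prod_def algebra_simps)
  show "cinner y x = cnj (cinner x y)"
    by (simp add: cinner_prod_def) (metis cinner_commute)
  show "0 \<le> Re (cinner x x)"
    by (simp add: cinner_prod_def cinner_self_nonneg add_nonneg_nonneg)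
  have a: "Re (cinner (fst x) (fst x)) = (norm (fst x))\<^sup>2"
    by (simp add: norm_eq_cinner cinner_self_nonneg)
  have b: "Re (cinner (snd x) (snd x)) = (norm (snd x))\<^sup>2"
    by (simp add: norm_eq_cinner cinner_self_nonneg)
  show "norm x = sqrt (Re (cinner x x))"
    by (simp add: cinner_prod_def a b norm_prod_def)
qed
end

instance prod :: (chilbert, chilbert) chilbert ..

definition clinear :: "('a::complex_inner \<Rightarrow> 'b::complex_inner) \<Rightarrow> bool" where
  "clinear T \<longleftrightarrow> (\<forall>x y. T (x + y) = T x + T y) \<and> (\<forall>c x. T (c *\<^sub>C x) = c *\<^sub>C T x)"

definition bounded_clinear :: "('a::complex_inner \<Rightarrow> 'b::complex_inner) \<Rightarrow> bool" where
  "bounded_clinear T \<longleftrightarrow> clinear T \<and> (\<exists>K. \<forall>x. norm (T x) \<le> norm x * K)"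

definition cadj :: "('a::complex_inner \<Rightarrow> 'b::complex_inner) \<Rightarrow> ('b \<Rightarrow> 'a)" where
  "cadj T = (THE S. \<forall>x y. cinner (T x) y = cinner x (S y))"

definition cinvertible :: "('a::complex_inner \<Rightarrow> 'b::complex_inner) \<Rightarrow> bool" where
  "cinvertible T \<longleftrightarrow> bounded_clinear T \<and>
     (\<exists>S. bounded_clinear S \<and> S \<circ> T = id \<and> T \<circ> S = id)"

definition cinverse :: "('a::complex_inner \<Rightarrow> 'b::complex_inner) \<Rightarrow> ('b \<Rightarrow> 'a)" where
  "cinverse T = (THE S. bounded_clinear S \<and> S \<circ> T = id \<and> T \<circ> S = id)"

definition cspectrum :: "('a::complex_inner \<Rightarrow> 'a) \<Rightarrow> complex set" where
  "cspectrum T = {l. \<not> cinvertible (\<lambda>x. l *\<^sub>C x - T x)}"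

text \<open>A selfadjoint involution (fundamental symmetry); for an auxiliary space \<open>J = I\<close> is allowed.\<close>
definition sa_involution :: "('a::chilbert \<Rightarrow> 'a) \<Rightarrow> bool" where
  "sa_involution J \<longleftrightarrow> bounded_clinear J \<and> cadj J = J \<and> J \<circ> J = id"

definition krein_space :: "('a::chilbert \<Rightarrow> 'a) \<Rightarrow> bool" where
  "krein_space J \<longleftrightarrow> sa_involution J \<and> J \<noteq> id \<and> J \<noteq> uminus"

definition ksharp :: "('a::chilbert \<Rightarrow> 'a) \<Rightarrow> ('b::chilbert \<Rightarrow> 'b) \<Rightarrow> ('a \<Rightarrow> 'b) \<Rightarrow> ('b \<Rightarrow> 'a)" where
  "ksharp J1 J2 T = J1 \<circ> cadj T \<circ> J2"

text \<open>\<open>A \<le>\<^sup>J B\<close>: \<open>[Ax,x]\<^sub>J \<le> [Bx,x]\<^sub>J\<close> for all \<open>x\<close>, where \<open>[x,y]\<^sub>J = \<langle>Jx,y\<rangle>\<close> and the inequality is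
  between (necessarily real) complex numbers, i.e. in the usual partial order on \<open>\<complex>\<close>
  (\<open>a \<le> b\<close> iff \<open>Re a \<le> Re b\<close> and \<open>Im a = Im b\<close>).\<close>
definition kle :: "('a::chilbert \<Rightarrow> 'a) \<Rightarrow> ('a \<Rightarrow> 'a) \<Rightarrow> ('a \<Rightarrow> 'a) \<Rightarrow> bool" where
  "kle J A B \<longleftrightarrow> (\<forall>x. Re (cinner (J (A x)) x) \<le> Re (cinner (J (B x)) x) \<and>
                       Im (cinner (J (A x)) x) = Im (cinner (J (B x)) x))"

definition kpositive :: "('a::chilbert \<Rightarrow> 'a) \<Rightarrow> ('a \<Rightarrow> 'a) \<Rightarrow> bool" where
  "kpositive J A \<longleftrightarrow> bounded_clinear A \<and> kle J (\<lambda>_. 0) A"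

definition kcontraction :: "('a::chilbert \<Rightarrow> 'a) \<Rightarrow> ('a \<Rightarrow> 'a) \<Rightarrow> bool" where
  "kcontraction J C \<longleftrightarrow> bounded_clinear C \<and> kle J (ksharp J J C \<circ> C) id"

definition defect_operator ::
  "('c::chilbert \<Rightarrow> 'c) \<Rightarrow> ('a::chilbert \<Rightarrow> 'a) \<Rightarrow> ('b::chilbert \<Rightarrow> 'b) \<Rightarrow> ('a \<Rightarrow> 'b) \<Rightarrow> ('c \<Rightarrow> 'a) \<Rightarrow> bool" where
  "defect_operator Jt J1 J2 T E \<longleftrightarrow> sa_involution Jt \<and> bounded_clinear E \<and>
     (\<forall>x. E x = 0 \<longrightarrow> x = 0) \<and>
     (\<lambda>x. x - ksharp J1 J2 T (T x)) = E \<circ> ksharp Jt J1 E"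

definition admissible_cycles :: "complex set \<Rightarrow> complex set \<Rightarrow> (real \<Rightarrow> complex) list \<Rightarrow> bool" where
  "admissible_cycles U S \<Gamma> \<longleftrightarrow>
     (\<forall>\<gamma>\<in>set \<Gamma>. valid_path \<gamma> \<and> pathfinish \<gamma> = pathstart \<gamma> \<and> path_image \<gamma> \<subseteq> U - S) \<and>
     (\<forall>z\<in>S. (\<Sum>\<gamma>\<leftarrow>\<Gamma>. winding_number \<gamma> z) = 1) \<and>
     (\<forall>z. z \<notin> U \<longrightarrow> (\<Sum>\<gamma>\<leftarrow>\<Gamma>. winding_number \<gamma> z) = 0)"

definition riesz_integral :: "(complex \<Rightarrow> complex) \<Rightarrow> ('a::chilbert \<Rightarrow> 'a) \<Rightarrow> (real \<Rightarrow> complex) list \<Rightarrow> 'a \<Rightarrow> 'a" where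
  "riesz_integral f T \<Gamma> x = (1 / (2 * pi * \<i>)) *\<^sub>C
     (\<Sum>\<gamma>\<leftarrow>\<Gamma>. integral {0..1} (\<lambda>t. (vector_derivative \<gamma> (at t within {0..1}) * f (\<gamma> t)) *\<^sub>C
                                       cinverse (\<lambda>y. \<gamma> t *\<^sub>C y - T y) x))"

definition fcalc :: "complex set \<Rightarrow> (complex \<Rightarrow> complex) \<Rightarrow> ('a::chilbert \<Rightarrow> 'a) \<Rightarrow> ('a \<Rightarrow> 'a)" where
  "fcalc U f T = (THE F. \<forall>\<Gamma>. admissible_cycles U (cspectrum T) \<Gamma> \<longrightarrow> F = riesz_integral f T \<Gamma>)"

text \<open>Since HOL cannot quantify over types inside a formula, convexity is relative to the type of
  the underlying Hilbert space (all Krein space structures \<open>J\<close> on it).\<close>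
definition krein_op_convex :: "'h::chilbert itself \<Rightarrow> complex set \<Rightarrow> (complex \<Rightarrow> complex) \<Rightarrow> bool" where
  "krein_op_convex _ U f \<longleftrightarrow> f analytic_on U \<and> (\<forall>x::real. complex_of_real x \<in> U \<longrightarrow> f x \<in> \<real>) \<and>
     (\<forall>(J::'h \<Rightarrow> 'h) A B (l::real). krein_space J \<longrightarrow> kpositive J A \<longrightarrow> kpositive J B \<longrightarrow>
        0 \<le> l \<longrightarrow> l \<le> 1 \<longrightarrow>
        cspectrum A \<subseteq> U \<longrightarrow> cspectrum B \<subseteq> U \<longrightarrow>
        cspectrum (\<lambda>x. (1 - l) *\<^sub>R A x + l *\<^sub>R B x) \<subseteq> U \<longrightarrow>
        kle J (fcalc U f (\<lambda>x. (1 - l) *\<^sub>R A x + l *\<^sub>R B x))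
              (\<lambda>x. (1 - l) *\<^sub>R fcalc U f A x + l *\<^sub>R fcalc U f B x))"

end

theory Submission
  imports Defs
begin

text \<open>Write \<open>R\<^sub>\<plusminus> = [C, \<plusminus>D]\<close>, an operator from the direct sum of the two spaces to the first one. The
  defect identity says \<open>R\<^sub>\<plusminus> R\<^sub>\<plusminus>\<^sup>\<sharp> = I\<close>, and then \<open>f(R\<^sub>\<plusminus>\<^sup>\<sharp> A R\<^sub>\<plusminus>) = R\<^sub>\<plusminus>\<^sup>\<sharp> f(A) R\<^sub>\<plusminus>\<close> because \<open>f(0) = 0\<close>.
  The mean of \<open>R\<^sub>+\<^sup>\<sharp> A R\<^sub>+\<close> and \<open>R\<^sub>-\<^sup>\<sharp> A R\<^sub>-\<close> is the diagonal operator with entries \<open>C\<^sup>\<sharp> A C\<close> and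
  \<open>D\<^sup>\<sharp> A D\<close>, so convexity with weights \<open>1/2\<close>, tested on vectors \<open>(x, 0)\<close>, is the claim; no unitary
  dilation of \<open>C\<close> is needed.

  The functional calculus is defined by quantifying over all admissible cycles, so it must be
  shown that such cycles exist (boundaries of unions of small grid squares) and that the integral
  does not depend on the choice (the homology form of Cauchy's theorem).\<close>

section \<open>Complex Hilbert spaces\<close>

text \<open>The two signs serve to remove the off-diagonal entries
  \<open>C\<^sup>\<sharp> A D\<close> and \<open>D\<^sup>\<sharp> A C\<close>: they change sign with
  \<open>D\<close> and cancel in the mean, while the diagonal entries do not see the sign. On
  \<open>(x, 0)\<close> both row operators give \<open>C x\<close>, so the right-hand side of the
  convexity inequality collapses to one term. The compressions have their spectra in that of
  \<open>A\<close> together with 0, whence \<open>0 \<in> U\<close>; the spectrum of the mean is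
  controlled by its two diagonal entries, whence the condition on
  \<open>D\<^sup>\<sharp> A D\<close>. As the second summand is the space of the defect operator,
  convexity is applied on the product type.

  On the analytic side the difficulty is that the Riesz integral is vector valued. Pairing with a
  fixed vector turns it into a contour integral of the scalar function
  \<open>f z * cinner (cresolvent T z x) y\<close>, to which Cauchy's theorem for cycles applies.
  Pairing does not yield the existence of the vector integral along a valid path; that comes from
  local primitives.\<close>

instance chilbert \<subseteq> banach ..

lemma scaleC_zero_right [simp]: "c *\<^sub>C (0::'a::complex_inner) = 0"
  using scaleC_add_right[of c 0 "0::'a"] by simp

lemma scaleC_zero_left [simp]: "0 *\<^sub>C (x::'a::complex_inner) = 0"
  using scaleC_add_left[of 0 0 x] by simp

lemma scaleC_minus_right: "c *\<^sub>C (- x::'a::complex_inner) = - (c *\<^sub>C x)"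
  using scaleC_add_right[of c x "-x"] by (simp add: add_eq_0_iff2)

lemma scaleC_minus_left: "(- c) *\<^sub>C (x::'a::complex_inner) = - (c *\<^sub>C x)"
  using scaleC_add_left[of c "-c" x] by (simp add: add_eq_0_iff2)

lemma scaleC_diff_right: "c *\<^sub>C (x - y::'a::complex_inner) = c *\<^sub>C x - c *\<^sub>C y"
  using scaleC_add_right[of c x "-y"] by (simp add: scaleC_minus_right)

lemma scaleC_diff_left: "(c - d) *\<^sub>C (x::'a::complex_inner) = c *\<^sub>C x - d *\<^sub>C x"
  using scaleC_add_left[of c "-d" x] by (simp add: scaleC_minus_left)

lemma cinner_add_right: "cinner x (y + z) = cinner x y + cinner x z"
  by (metis cinner_add_left cinner_commute complex_cnj_add)

lemma cinner_scaleC_right: "cinner x (c *\<^sub>C y) = cnj c * cinner x y"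
  by (metis cinner_commute cinner_scaleC_left complex_cnj_mult)

lemma cinner_zero_left [simp]: "cinner 0 x = 0"
  using cinner_add_left[of 0 0 x] by simp

lemma cinner_zero_right [simp]: "cinner x 0 = 0"
  by (metis cinner_commute cinner_zero_left complex_cnj_zero)

lemma cinner_minus_left: "cinner (- x) y = - cinner x y"
  using cinner_add_left[of x "-x" y] by (simp add: add_eq_0_iff2)

lemma cinner_diff_left: "cinner (x - y) z = cinner x z - cinner y z"
  using cinner_add_left[of x "-y" z] by (simp add: cinner_minus_left)

lemma cinner_self: "cinner x x = complex_of_real ((norm x)\<^sup>2)"
proof -
  have "Im (cinner x x) = 0"
    by (metis cinner_commute add.inverse_neutral complex_cnj_cancel_iff complex_eq_iff cnj.simps(2) equal_neg_zero)
  then show ?thesis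
    by (simp add: complex_eq_iff norm_eq_cinner cinner_self_nonneg)
qed

lemma cinner_eqI:
  assumes "\<And>z. cinner x z = cinner y z"
  shows "x = y"
proof -
  have "cinner (x - y) (x - y) = 0"
    using assms by (simp add: cinner_diff_left)
  then show ?thesis by (simp add: cinner_self)
qed

lemma cinner_eqI_right:
  assumes "\<And>z. cinner z x = cinner z y"
  shows "x = y"
  by (rule cinner_eqI) (metis assms cinner_commute)

lemma norm_scaleC: "norm (c *\<^sub>C x) = cmod c * norm x"
proof -
  have "complex_of_real ((norm (c *\<^sub>C x))\<^sup>2) = complex_of_real ((cmod c * norm x)\<^sup>2)"
    unfolding cinner_self[symmetric] cinner_scaleC_left cinner_scaleC_right
    by (simp add: cinner_self power_mult_distrib complex_norm_square[of c, simplified] algebra_simps)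
  then show ?thesis
    by (simp del: of_real_power add: power2_eq_iff_nonneg)
qed

lemma norm_add_scaleC_power2:
  "(norm (x + c *\<^sub>C y))\<^sup>2 = (norm x)\<^sup>2 + 2 * Re (c * cinner y x) + (cmod c)\<^sup>2 * (norm y)\<^sup>2"
proof -
  have 1: "cinner x (c *\<^sub>C y) = cnj (c * cinner y x)"
    by (simp add: cinner_scaleC_right cinner_commute[of y x])
  have "cinner (x + c *\<^sub>C y) (x + c *\<^sub>C y) =
      cinner x x + c * cinner y x + cnj (c * cinner y x) + cinner (c *\<^sub>C y) (c *\<^sub>C y)"
    by (simp add: cinner_add_left cinner_add_right 1 cinner_scaleC_left)
  then have "Re (cinner (x + c *\<^sub>C y) (x + c *\<^sub>C y)) = 
      Re (cinner x x) + 2 * Re (c * cinner y x) + Re (cinner (c *\<^sub>C y) (c *\<^sub>C y))"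
    by simp
  then show ?thesis
    unfolding cinner_self norm_scaleC by (simp add: power_mult_distrib)
qed

text \<open>The minimum of \<open>c \<mapsto> \<parallel>x + c y\<parallel>\<^sup>2\<close> is attained at \<open>c = - \<langle>x, y\<rangle> / \<parallel>y\<parallel>\<^sup>2\<close>.\<close>
lemma norm_minus_projection_power2:
  assumes "y \<noteq> 0"
  shows "(norm (x + (- cinner x y / (norm y)\<^sup>2) *\<^sub>C y))\<^sup>2 = (norm x)\<^sup>2 - (cmod (cinner x y))\<^sup>2 / (norm y)\<^sup>2"
proof -
  have ny: "norm y > 0" using assms by simp
  have "- cinner x y / complex_of_real ((norm y)\<^sup>2) * cinner y x
      = - complex_of_real ((cmod (cinner x y))\<^sup>2 / (norm y)\<^sup>2)"
    using ny by (simp add: cinner_commute[of x y] complex_norm_square[of "cinner y x", simplified] mult.commute)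
  then have "Re (- cinner x y / (norm y)\<^sup>2 * cinner y x) = - ((cmod (cinner x y))\<^sup>2 / (norm y)\<^sup>2)"
    by (simp only: Re_complex_of_real uminus_complex.simps(1))
  moreover have "(cmod (- cinner x y / complex_of_real ((norm y)\<^sup>2)))\<^sup>2 * (norm y)\<^sup>2 = (cmod (cinner x y))\<^sup>2 / (norm y)\<^sup>2"
    using ny by (simp add: norm_divide norm_power power_divide) (simp add: power2_eq_square power4_eq_xxxx)
  ultimately show ?thesis
    unfolding norm_add_scaleC_power2 by linarith
qed

lemma cinner_Cauchy_Schwarz: "cmod (cinner x y) \<le> norm x * norm y"
proof (cases "y = 0")
  case False
  then have "(cmod (cinner x y))\<^sup>2 / (norm y)\<^sup>2 \<le> (norm x)\<^sup>2"
    using norm_minus_projection_power2[OF False, of x]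
      zero_le_power2[of "norm (x + (- cinner x y / (norm y)\<^sup>2) *\<^sub>C y)"] by linarith
  then have "(cmod (cinner x y))\<^sup>2 \<le> (norm x * norm y)\<^sup>2"
    using False by (simp add: pos_divide_le_eq power_mult_distrib)
  then show ?thesis
    by (rule power2_le_imp_le) simp
qed simp

lemma bounded_bilinear_scaleC:
  "bounded_bilinear (scaleC :: complex \<Rightarrow> 'a \<Rightarrow> 'a::complex_inner)"
proof
  show "(a + a') *\<^sub>C b = a *\<^sub>C b + a' *\<^sub>C b" for a a' and b :: 'a
    by (rule scaleC_add_left)
  show "a *\<^sub>C (b + b') = a *\<^sub>C b + a *\<^sub>C b'" for a and b b' :: 'a
    by (rule scaleC_add_right)
  show "(r *\<^sub>R a) *\<^sub>C b = r *\<^sub>R (a *\<^sub>C b)" for r a and b :: 'a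
    by (simp add: scaleR_scaleC[where 'a='a] scaleC_scaleC scaleR_conv_of_real)
  show "a *\<^sub>C (r *\<^sub>R b) = r *\<^sub>R (a *\<^sub>C b)" for r a and b :: 'a
    by (simp add: scaleR_scaleC[where 'a='a] scaleC_scaleC mult.commute)
  show "\<exists>K. \<forall>a (b::'a). norm (a *\<^sub>C b) \<le> norm a * norm b * K"
    by (intro exI[of _ 1]) (simp add: norm_scaleC)
qed

lemma bounded_bilinear_cinner:
  "bounded_bilinear (cinner :: 'a::complex_inner \<Rightarrow> 'a \<Rightarrow> complex)"
proof
  show "cinner (a + a') b = cinner a b + cinner a' b" for a a' b :: 'a
    by (rule cinner_add_left)
  show "cinner a (b + b') = cinner a b + cinner a b'" for a b b' :: 'a
    by (rule cinner_add_right)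
  show "cinner (r *\<^sub>R a) b = r *\<^sub>R cinner a b" for r and a b :: 'a
    by (simp add: scaleR_scaleC[where 'a='a] cinner_scaleC_left scaleR_conv_of_real)
  show "cinner a (r *\<^sub>R b) = r *\<^sub>R cinner a b" for r and a b :: 'a
    by (simp add: scaleR_scaleC[where 'a='a] cinner_scaleC_right scaleR_conv_of_real)
  show "\<exists>K. \<forall>a b::'a. norm (cinner a b) \<le> norm a * norm b * K"
    by (intro exI[of _ 1]) (simp add: cinner_Cauchy_Schwarz)
qed

lemmas continuous_on_scaleC [continuous_intros] =
  bounded_bilinear.continuous_on[OF bounded_bilinear_scaleC]
lemmas tendsto_cinner [tendsto_intros] = bounded_bilinear.tendsto[OF bounded_bilinear_cinner]
lemmas continuous_on_cinner [continuous_intros] =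
  bounded_bilinear.continuous_on[OF bounded_bilinear_cinner]
lemmas bounded_linear_cinner_left = bounded_bilinear.bounded_linear_left[OF bounded_bilinear_cinner]

lemma parallelogram:
  "(norm (x + y))\<^sup>2 + (norm (x - y))\<^sup>2 = 2 * (norm x)\<^sup>2 + 2 * (norm (y::'a::complex_inner))\<^sup>2"
  using norm_add_scaleC_power2[of x 1 y] norm_add_scaleC_power2[of x "-1" y]
  by (simp add: scaleC_one scaleC_minus_left)

text \<open>For nonzero \<phi> the closed hyperplane where \<phi> equals 1 contains a vector
  \<open>z\<close> of minimal norm. Minimality makes \<open>z\<close> orthogonal to the kernel, so
  \<phi> is the inner product with a multiple of \<open>z\<close>.\<close>

theorem Riesz_representation:
  fixes \<phi> :: "'a::chilbert \<Rightarrow> complex"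
  assumes add: "\<And>x y. \<phi> (x + y) = \<phi> x + \<phi> y"
    and scale: "\<And>c x. \<phi> (c *\<^sub>C x) = c * \<phi> x"
    and bounded: "\<And>x. cmod (\<phi> x) \<le> norm x * K"
  obtains y where "\<And>x. \<phi> x = cinner x y"
proof (cases "\<forall>x. \<phi> x = 0")
  case True
  then show ?thesis using that[of 0] by simp
next
  case False
  have lin: "bounded_linear \<phi>"
    by (rule bounded_linear_intro[where K=K])
      (auto simp: add scale scaleR_scaleC bounded scaleR_conv_of_real)
  obtain x0 where x0: "\<phi> x0 = 1"
  proof -
    obtain x where "\<phi> x \<noteq> 0" using False by blast
    then have "\<phi> ((1 / \<phi> x) *\<^sub>C x) = 1" by (simp add: scale)
    then show ?thesis using that by blast
  qed
  define S where "S = {x. \<phi> x = 1}"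
  define d where "d = Inf (norm ` S)"
  have bdd: "bdd_below (norm ` S)" by (rule bdd_belowI[of _ 0]) auto
  have "norm ` S \<noteq> {}" using x0 S_def by auto
  have d_le: "d \<le> norm x" if "x \<in> S" for x
    unfolding d_def using that bdd by (auto intro: cInf_lower)
  have "0 \<le> d" unfolding d_def using \<open>norm ` S \<noteq> {}\<close> by (auto intro: cInf_greatest)
  have "\<exists>x\<in>S. norm x < d + 1 / real (Suc n)" for n
    using cInf_lessD[OF \<open>norm ` S \<noteq> {}\<close>, of "d + 1 / real (Suc n)"] d_def by fastforce
  then obtain X where XS: "\<And>n. X n \<in> S" and Xd: "\<And>n. norm (X n) < d + 1 / real (Suc n)"
    by metis
  \<comment> \<open>The midpoint of two points of \<open>S\<close> is again in \<open>S\<close>, so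
    its norm is at least \<open>d\<close>. The parallelogram law then bounds their distance by the
    excess of their norms over \<open>d\<close>, which makes minimizing sequences Cauchy.\<close>
  have est: "(norm (x - y))\<^sup>2 \<le> 2 * ((norm x)\<^sup>2 - d\<^sup>2) + 2 * ((norm y)\<^sup>2 - d\<^sup>2)"
    if "x \<in> S" "y \<in> S" for x y
  proof -
    have "(1/2) *\<^sub>R (x + y) \<in> S"
      using that by (simp add: S_def scaleR_scaleC scale add)
    then have "d \<le> norm (x + y) / 2" using d_le by fastforce
    then have "(2 * d)\<^sup>2 \<le> (norm (x + y))\<^sup>2"
      using \<open>0 \<le> d\<close> by (intro power_mono) auto
    then show ?thesis using parallelogram[of x y] by (simp add: power_mult_distrib)
  qed
  have lim_norm: "(\<lambda>n. norm (X n)) \<longlonglongrightarrow> d"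
  proof (rule tendsto_sandwich)
    show "\<forall>\<^sub>F n in sequentially. d \<le> norm (X n)" using d_le XS by simp
    show "\<forall>\<^sub>F n in sequentially. norm (X n) \<le> d + 1 / real (Suc n)"
      using Xd by (simp add: less_imp_le)
    show "(\<lambda>n. d + 1 / real (Suc n)) \<longlonglongrightarrow> d"
      using tendsto_add[OF tendsto_const[of d] LIMSEQ_inverse_real_of_nat]
      by (simp add: inverse_eq_divide)
  qed simp
  have "Cauchy X"
  proof (rule metric_CauchyI)
    fix e :: real assume "e > 0"
    have "(\<lambda>n. (norm (X n))\<^sup>2 - d\<^sup>2) \<longlonglongrightarrow> d\<^sup>2 - d\<^sup>2"
      by (intro tendsto_intros lim_norm)
    then have "\<forall>\<^sub>F n in sequentially. (norm (X n))\<^sup>2 - d\<^sup>2 < e\<^sup>2 / 4"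
      using \<open>e > 0\<close> by (intro order_tendstoD(2)) auto
    then obtain N where N: "\<And>n. n \<ge> N \<Longrightarrow> (norm (X n))\<^sup>2 - d\<^sup>2 < e\<^sup>2 / 4"
      by (auto simp: eventually_sequentially)
    have "dist (X m) (X n) < e" if "m \<ge> N" "n \<ge> N" for m n
    proof -
      have "(norm (X m - X n))\<^sup>2 < e\<^sup>2"
        using add_strict_mono[OF N[OF that(1)] N[OF that(2)]] est[OF XS XS, of m n] by argo
      then show ?thesis
        using \<open>e > 0\<close> by (simp add: dist_norm power2_less_imp_less)
    qed
    then show "\<exists>M. \<forall>m\<ge>M. \<forall>n\<ge>M. dist (X m) (X n) < e" by blast
  qed
  then obtain z where z: "X \<longlonglongrightarrow> z" using Cauchy_convergent convergent_def by blast
  have "(\<lambda>n. \<phi> (X n)) \<longlonglongrightarrow> \<phi> z" by (rule bounded_linear.tendsto[OF lin z])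
  then have \<phi>z: "\<phi> z = 1"
    using XS LIMSEQ_unique[OF tendsto_const] by (fastforce simp: S_def)
  have norm_z: "norm z = d"
    using LIMSEQ_unique[OF tendsto_norm[OF z] lim_norm] .
  \<comment> \<open>Adding a multiple of \<open>k\<close> stays in \<open>S\<close> and so cannot
    shorten \<open>z\<close>; the optimal multiple would shorten it unless \<open>k\<close> and
    \<open>z\<close> are orthogonal.\<close>
  have orth: "cinner k z = 0" if "\<phi> k = 0" for k
  proof (cases "k = 0")
    case False
    have "z + (- cinner z k / (norm k)\<^sup>2) *\<^sub>C k \<in> S"
      using that \<phi>z by (simp add: S_def add scale)
    then have "(norm z)\<^sup>2 \<le> (norm (z + (- cinner z k / (norm k)\<^sup>2) *\<^sub>C k))\<^sup>2"
      using d_le norm_z \<open>0 \<le> d\<close> by (intro power_mono) auto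
    then have "(cmod (cinner z k))\<^sup>2 / (norm k)\<^sup>2 \<le> 0"
      unfolding norm_minus_projection_power2[OF False, of z] by simp
    then have "cinner z k = 0"
      using False by (simp add: divide_le_0_iff)
    then show ?thesis by (simp add: cinner_commute[of z k])
  qed simp
  have zn: "norm z \<noteq> 0" using \<phi>z scale[of 0 z] by auto
  have "\<phi> x = cinner x ((1 / complex_of_real ((norm z)\<^sup>2)) *\<^sub>C z)" for x
  proof -
    have "\<phi> (x + (- \<phi> x) *\<^sub>C z) = 0" by (simp only: add scale \<phi>z) simp
    from orth[OF this] have "cinner x z = \<phi> x * (norm z)\<^sup>2"
      by (simp add: cinner_add_left cinner_scaleC_left cinner_self)
    then show ?thesis using zn by (simp add: cinner_scaleC_right)
  qed
  then show ?thesis using that by blast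
qed

section \<open>Bounded operators and their adjoints\<close>

lemma bounded_clinearD:
  assumes "bounded_clinear T"
  shows "T (x + y) = T x + T y" "T (c *\<^sub>C x) = c *\<^sub>C T x" "T 0 = 0" "T (- x) = - T x"
    "T (x - y) = T x - T y"
proof -
  show 1: "T (x + y) = T x + T y" and 2: "T (c *\<^sub>C x) = c *\<^sub>C T x" for x y c
    using assms by (auto simp: bounded_clinear_def clinear_def)
  show "T 0 = 0" using 2[of 0 0] by simp
  show 3: "T (- x) = - T x" for x using 2[of "-1" x] by (simp add: scaleC_minus_left scaleC_one)
  show "T (x - y) = T x - T y" using 1[of x "-y"] 3 by simp
qed

lemma bounded_clinear_pos:
  assumes "bounded_clinear T"
  obtains K where "K > 0" "\<And>x. norm (T x) \<le> norm x * K"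
proof -
  obtain K where K: "\<And>x. norm (T x) \<le> norm x * K" using assms by (auto simp: bounded_clinear_def)
  have "norm (T x) \<le> norm x * max K 1" for x
    by (rule order_trans[OF K mult_left_mono]) auto
  then show ?thesis using that[of "max K 1"] by auto
qed

lemma bounded_clinear_intro:
  assumes "\<And>x y. T (x + y) = T x + T y" "\<And>c x. T (c *\<^sub>C x) = c *\<^sub>C T x"
    "\<And>x. norm (T x) \<le> norm x * K"
  shows "bounded_clinear T"
  using assms by (auto simp: bounded_clinear_def clinear_def)

lemma bounded_clinear_compose:
  assumes S: "bounded_clinear S" and T: "bounded_clinear T"
  shows "bounded_clinear (S \<circ> T)"
proof -
  obtain K where "K > 0" and K: "\<And>x. norm (S x) \<le> norm x * K"
    by (rule bounded_clinear_pos[OF S]) (rule that)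
  obtain L where "L > 0" and L: "\<And>x. norm (T x) \<le> norm x * L"
    by (rule bounded_clinear_pos[OF T]) (rule that)
  have "norm (S (T x)) \<le> norm x * (L * K)" for x
    using order_trans[OF K[of "T x"]] mult_right_mono[OF L[of x], of K] \<open>K > 0\<close>
    by (simp add: mult.assoc)
  then show ?thesis
    by (intro bounded_clinear_intro[where K = "L * K"])
      (simp_all add: bounded_clinearD(1,2)[OF S] bounded_clinearD(1,2)[OF T])
qed

lemma bounded_clinear_add:
  assumes S: "bounded_clinear S" and T: "bounded_clinear T"
  shows "bounded_clinear (\<lambda>x. S x + T x)"
proof -
  obtain K where "K > 0" and K: "\<And>x. norm (S x) \<le> norm x * K"
    by (rule bounded_clinear_pos[OF S]) (rule that)
  obtain L where "L > 0" and L: "\<And>x. norm (T x) \<le> norm x * L"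
    by (rule bounded_clinear_pos[OF T]) (rule that)
  have "norm (S x + T x) \<le> norm x * (K + L)" for x
    using norm_triangle_ineq[of "S x" "T x"] K[of x] L[of x] by (simp add: distrib_left)
  then show ?thesis
    by (rule bounded_clinear_intro[rotated 2])
      (simp_all add: bounded_clinearD(1,2)[OF S] bounded_clinearD(1,2)[OF T] scaleC_add_right)
qed

lemma bounded_clinear_scaleC:
  assumes T: "bounded_clinear T"
  shows "bounded_clinear (\<lambda>x. c *\<^sub>C T x)"
proof -
  obtain K where K: "K > 0" "\<And>x. norm (T x) \<le> norm x * K"
    by (rule bounded_clinear_pos[OF T]) (rule that)
  have "norm (c *\<^sub>C T x) \<le> norm x * (cmod c * K)" for x
    using mult_left_mono[OF K(2), of "cmod c" x] by (simp add: norm_scaleC algebra_simps)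
  then show ?thesis
    by (rule bounded_clinear_intro[rotated 2])
      (simp_all add: bounded_clinearD(1,2)[OF T] scaleC_add_right scaleC_scaleC mult.commute)
qed

lemma bounded_clinear_ident: "bounded_clinear (\<lambda>x. x)"
  by (rule bounded_clinear_intro[where K = 1]) auto

lemma bounded_clinear_minus: "bounded_clinear T \<Longrightarrow> bounded_clinear (\<lambda>x. - T x)"
  using bounded_clinear_scaleC[of T "-1"] by (simp add: scaleC_minus_left scaleC_one)

lemma bounded_clinear_diff:
  "bounded_clinear S \<Longrightarrow> bounded_clinear T \<Longrightarrow> bounded_clinear (\<lambda>x. S x - T x)"
  using bounded_clinear_add[OF _ bounded_clinear_minus, of S T] by simp

text \<open>With this, computing an adjoint amounts to checking the adjoint identity for a
  candidate, without touching the \<open>THE\<close>.\<close>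

lemma cadj_unique:
  assumes "\<And>x y. cinner (T x) y = cinner x (S y)"
  shows "cadj T = S"
  unfolding cadj_def
proof (rule the_equality)
  show "\<forall>x y. cinner (T x) y = cinner x (S y)" using assms by blast
  show "S' = S" if "\<forall>x y. cinner (T x) y = cinner x (S' y)" for S'
  proof
    fix y show "S' y = S y" by (rule cinner_eqI_right) (metis assms that)
  qed
qed

text \<open>The \<open>THE\<close> in \<open>cadj\<close> is meaningful only if an adjoint exists.
  For each \<open>y\<close>, Riesz representation of \<open>\<lambda>x. cinner (T x) y\<close>
  supplies its value at \<open>y\<close>; completeness of the domain enters here.\<close>

lemma cinner_cadj:
  fixes T :: "'a::chilbert \<Rightarrow> 'b::complex_inner"
  assumes T: "bounded_clinear T"
  shows "cinner (T x) y = cinner x (cadj T y)"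
proof -
  obtain K where K: "K > 0" "\<And>x. norm (T x) \<le> norm x * K"
    by (rule bounded_clinear_pos[OF T]) (rule that)
  have "\<exists>s. \<forall>x. cinner (T x) y = cinner x s" for y
  proof -
    have "cmod (cinner (T x) y) \<le> norm x * (K * norm y)" for x
      using order_trans[OF cinner_Cauchy_Schwarz[of "T x" y]] mult_right_mono[OF K(2)[of x], of "norm y"]
      by (simp add: mult.assoc)
    then obtain s where "\<And>x. cinner (T x) y = cinner x s"
      by (rule Riesz_representation[of "\<lambda>x. cinner (T x) y" "K * norm y", rotated 2])
        (simp_all add: bounded_clinearD(1,2)[OF T] cinner_add_left cinner_scaleC_left)
    then show ?thesis by blast
  qed
  then obtain S where "\<And>x y. cinner (T x) y = cinner x (S y)" by metis
  then show ?thesis using cadj_unique[of T S] by simp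
qed

lemma cinner_cadj':
  fixes T :: "'a::chilbert \<Rightarrow> 'b::complex_inner"
  assumes "bounded_clinear T"
  shows "cinner (cadj T y) x = cinner y (T x)"
  using cinner_cadj[OF assms, of x y] by (simp add: cinner_commute[of _ x] cinner_commute[of _ "T x"])

lemma bounded_clinear_cadj:
  fixes T :: "'a::chilbert \<Rightarrow> 'b::complex_inner"
  assumes T: "bounded_clinear T"
  shows "bounded_clinear (cadj T)"
proof -
  obtain K where K: "K > 0" "\<And>x. norm (T x) \<le> norm x * K"
    by (rule bounded_clinear_pos[OF T]) (rule that)
  have "norm (cadj T y) \<le> norm y * K" for y
  proof -
    have "(norm (cadj T y))\<^sup>2 = cmod (cinner (cadj T y) (cadj T y))"
      by (simp add: cinner_self norm_power)
    also have "\<dots> = cmod (cinner y (T (cadj T y)))"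
      by (simp add: cinner_cadj'[OF T])
    also have "\<dots> \<le> norm y * (norm (cadj T y) * K)"
      by (rule order_trans[OF cinner_Cauchy_Schwarz mult_left_mono[OF K(2)]]) simp
    finally have "norm (cadj T y) * norm (cadj T y) \<le> norm (cadj T y) * (norm y * K)"
      by (simp add: power2_eq_square algebra_simps)
    then show ?thesis
      using K(1) by (cases "cadj T y = 0") (auto simp: mult_le_cancel_left)
  qed
  then show ?thesis
  proof (rule bounded_clinear_intro[rotated 2])
    show "cadj T (x + y) = cadj T x + cadj T y" for x y
      by (rule cinner_eqI) (simp only: cinner_cadj'[OF T] cinner_add_left)
    show "cadj T (c *\<^sub>C x) = c *\<^sub>C cadj T x" for c x
      by (rule cinner_eqI) (simp only: cinner_cadj'[OF T] cinner_scaleC_left)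
  qed
qed

section \<open>Resolvents\<close>

lemma cinverse_unique:
  assumes "bounded_clinear S" "\<And>x. S (T x) = x" "\<And>x. T (S x) = x"
  shows "cinverse T = S"
  unfolding cinverse_def
proof (rule the_equality)
  show "bounded_clinear S \<and> S \<circ> T = id \<and> T \<circ> S = id" using assms by auto
  show "S' = S" if "bounded_clinear S' \<and> S' \<circ> T = id \<and> T \<circ> S' = id" for S'
  proof
    fix y
    have "S' (T (S y)) = S y" using that by (metis comp_apply id_apply)
    then show "S' y = S y" using assms by simp
  qed
qed

lemma cinvertibleI:
  assumes "bounded_clinear T" "bounded_clinear S" "\<And>x. S (T x) = x" "\<And>x. T (S x) = x"
  shows "cinvertible T"
  using assms unfolding cinvertible_def by (intro conjI exI[of _ S]) auto

lemma cinverse: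
  assumes "cinvertible T"
  shows "bounded_clinear (cinverse T)" "cinverse T (T x) = x" "T (cinverse T x) = x"
proof -
  obtain S where S: "bounded_clinear S" "S \<circ> T = id" "T \<circ> S = id"
    using assms unfolding cinvertible_def by blast
  then have S': "\<And>x. S (T x) = x" "\<And>x. T (S x) = x" by (metis comp_apply id_apply)+
  have "cinverse T = S" by (rule cinverse_unique) (use S S' in auto)
  then show "bounded_clinear (cinverse T)" "cinverse T (T x) = x" "T (cinverse T x) = x"
    using S S' by auto
qed

text \<open>Inverting \<open>I - B\<close> amounts to finding the fixed point of \<open>x \<mapsto> y + B x\<close>.\<close>
lemma cinvertible_perturbed_identity:
  fixes B :: "'a::chilbert \<Rightarrow> 'a"
  assumes B: "bounded_clinear B" and q: "0 \<le> q" "q < 1" "\<And>x. norm (B x) \<le> q * norm x"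
  shows "cinvertible (\<lambda>x. x - B x)"
    and "norm (cinverse (\<lambda>x. x - B x) y) \<le> norm y / (1 - q)"
proof -
  note lin = bounded_clinearD[OF B]
  have "\<exists>!x. y + B x = x" for y
  proof (rule banach_fix_type[OF q(1,2)], intro allI)
    fix x x' show "dist (y + B x) (y + B x') \<le> q * dist x x'"
      using q(3)[of "x - x'"] by (simp add: dist_norm lin)
  qed
  then obtain S where S: "\<And>y. y + B (S y) = S y" and
    uniq: "\<And>x y. y + B x = x \<Longrightarrow> x = S y" by metis
  have bound: "norm (S y) \<le> norm y * (1 / (1 - q))" for y
  proof -
    have "norm (S y) \<le> norm y + q * norm (S y)"
      using norm_triangle_ineq[of y "B (S y)"] q(3)[of "S y"] S[of y] by simp
    then show ?thesis using q(2) by (simp add: field_simps)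
  qed
  \<comment> \<open>Linearity comes from uniqueness of fixed points: the sum of the fixed points for
    \<open>x\<close> and \<open>y\<close> is a fixed point for \<open>x + y\<close>, and likewise
    for multiples.\<close>
  have bS: "bounded_clinear S"
  proof (rule bounded_clinear_intro[OF _ _ bound])
    show "S (x + y) = S x + S y" for x y
      by (rule uniq[symmetric]) (use S[of x] S[of y] in \<open>simp add: lin, metis add.assoc add.left_commute\<close>)
    show "S (c *\<^sub>C x) = c *\<^sub>C S x" for c x
      by (rule uniq[symmetric]) (use S[of x] in \<open>simp add: lin flip: scaleC_add_right\<close>)
  qed
  have inv: "S (x - B x) = x" "S x - B (S x) = x" for x
    using uniq[of "x - B x" x] S[of x] by (auto simp: algebra_simps)
  have b: "bounded_clinear (\<lambda>x. x - B x)"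
    by (rule bounded_clinear_diff[OF bounded_clinear_ident B])
  show "cinvertible (\<lambda>x. x - B x)"
    by (rule cinvertibleI[OF b bS inv])
  show "norm (cinverse (\<lambda>x. x - B x) y) \<le> norm y / (1 - q)"
    using bound[of y] cinverse_unique[OF bS inv] by simp
qed

definition cresolvent :: "('a::complex_inner \<Rightarrow> 'a) \<Rightarrow> complex \<Rightarrow> 'a \<Rightarrow> 'a" where
  "cresolvent T z = cinverse (\<lambda>x. z *\<^sub>C x - T x)"

lemma bounded_clinear_shift: "bounded_clinear T \<Longrightarrow> bounded_clinear (\<lambda>x. z *\<^sub>C x - T x)"
  by (intro bounded_clinear_diff bounded_clinear_scaleC[OF bounded_clinear_ident])

lemma cresolvent:
  assumes "z \<notin> cspectrum T"
  shows "bounded_clinear (cresolvent T z)"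
    "cresolvent T z (z *\<^sub>C x - T x) = x"
    "z *\<^sub>C cresolvent T z x - T (cresolvent T z x) = x"
  using assms cinverse[of "\<lambda>x. z *\<^sub>C x - T x"] by (auto simp: cspectrum_def cresolvent_def)

lemma cresolvent_unique:
  assumes T: "bounded_clinear T" and S: "bounded_clinear S"
    and inv: "\<And>x. S (z *\<^sub>C x - T x) = x" "\<And>x. z *\<^sub>C S x - T (S x) = x"
  shows "z \<notin> cspectrum T" "cresolvent T z = S"
proof -
  show "z \<notin> cspectrum T"
    unfolding cspectrum_def using cinvertibleI[OF bounded_clinear_shift[OF T] S inv] by blast
  show "cresolvent T z = S"
    unfolding cresolvent_def by (rule cinverse_unique[OF S inv])
qed

text \<open>Insert \<open>w - T\<close> before the resolvent at \<open>w\<close> in the first term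
  and \<open>z - T\<close> after the resolvent at \<open>z\<close> in the second. Both continuity
  and the complex derivative of the resolvent are read off from this identity.\<close>

lemma cresolvent_identity:
  assumes T: "bounded_clinear T" and zw: "z \<notin> cspectrum T" "w \<notin> cspectrum T"
  shows "cresolvent T z x - cresolvent T w x = (w - z) *\<^sub>C cresolvent T z (cresolvent T w x)"
proof -
  let ?R = "cresolvent T"
  have "?R z x - ?R w x = ?R z (w *\<^sub>C ?R w x - T (?R w x)) - ?R z (z *\<^sub>C ?R w x - T (?R w x))"
    using cresolvent[OF zw(1)] cresolvent[OF zw(2)] by simp
  also have "\<dots> = ?R z ((w - z) *\<^sub>C ?R w x)"
    by (simp add: scaleC_diff_left flip: bounded_clinearD(5)[OF cresolvent(1)[OF zw(1)]])
  also have "\<dots> = (w - z) *\<^sub>C ?R z (?R w x)"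
    by (rule bounded_clinearD[OF cresolvent(1)[OF zw(1)]])
  finally show ?thesis .
qed

text \<open>Factor \<open>z - T\<close> as \<open>I - B\<close> times \<open>z0 - T\<close>, where
  \<open>B\<close> is \<open>z0 - z\<close> times the resolvent at \<open>z0\<close>. The radius
  \<open>1 / (2 * K)\<close> makes the norm of \<open>B\<close> at most 1/2, so inverting
  \<open>I - B\<close> costs a factor of at most 2. The bound is uniform in \<open>z\<close>, which
  continuity of the resolvent relies on.\<close>

lemma cresolvent_nearby:
  fixes T :: "'a::chilbert \<Rightarrow> 'a"
  assumes T: "bounded_clinear T" and z0: "z0 \<notin> cspectrum T"
  obtains r M where "r > 0" "\<And>z. cmod (z - z0) < r \<Longrightarrow> z \<notin> cspectrum T"
    "\<And>z x. cmod (z - z0) < r \<Longrightarrow> norm (cresolvent T z x) \<le> M * norm x"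
proof -
  let ?R = "cresolvent T z0"
  note R = cresolvent[OF z0]
  obtain K where K: "K > 0" "\<And>x. norm (?R x) \<le> norm x * K"
    by (rule bounded_clinear_pos[OF R(1)]) (rule that)
  define r where "r = 1 / (2 * K)"
  have main: "z \<notin> cspectrum T \<and> norm (cresolvent T z x) \<le> (2 * K) * norm x"
    if z: "cmod (z - z0) < r" for z x
  proof -
    define B where "B x = (z0 - z) *\<^sub>C ?R x" for x
    have bB: "bounded_clinear B" unfolding B_def by (rule bounded_clinear_scaleC[OF R(1)])
    have nB: "norm (B x) \<le> (1/2) * norm x" for x
    proof -
      have "norm (B x) \<le> cmod (z - z0) * (norm x * K)"
        unfolding B_def norm_scaleC norm_minus_commute[of z] by (rule mult_left_mono[OF K(2)]) simp
      also have "\<dots> \<le> r * (norm x * K)"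
        using z K(1) by (intro mult_right_mono) auto
      finally show ?thesis using K(1) by (simp add: r_def)
    qed
    note P = cinvertible_perturbed_identity[OF bB _ _ nB]
    note inv = cinverse[OF P(1)]
    let ?S = "cinverse (\<lambda>x. x - B x)"
    have shift: "z *\<^sub>C x - T x = (z0 *\<^sub>C x - T x) - B (z0 *\<^sub>C x - T x)" for x
      unfolding B_def R by (simp add: scaleC_diff_left)
    have bS: "bounded_clinear (?R \<circ> ?S)" by (intro bounded_clinear_compose R inv) auto
    have "z *\<^sub>C ?R (?S x) - T (?R (?S x)) = x" for x
      unfolding shift R by (rule inv) auto
    moreover have "?R (?S (z *\<^sub>C x - T x)) = x" for x
      unfolding shift by (subst inv) (auto simp: R)
    ultimately have *: "z \<notin> cspectrum T" "cresolvent T z = ?R \<circ> ?S"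
      using cresolvent_unique[OF T bS] by auto
    have "norm (?R (?S x)) \<le> norm (?S x) * K" by (rule K)
    also have "\<dots> \<le> (norm x / (1 - 1/2)) * K"
      using K(1) by (intro mult_right_mono P(2)) auto
    finally show ?thesis using * by (simp add: algebra_simps)
  qed
  show ?thesis
    by (rule that[of r "2 * K"]) (use main K(1) r_def in auto)
qed

lemma open_compl_cspectrum:
  fixes T :: "'a::chilbert \<Rightarrow> 'a"
  assumes "bounded_clinear T"
  shows "open (- cspectrum T)"
  unfolding open_dist
  by (metis ComplD ComplI assms cresolvent_nearby dist_norm)

text \<open>For \<open>z\<close> beyond a norm bound of \<open>T\<close>, write \<open>z - T\<close>
  as \<open>z\<close> times \<open>I - T / z\<close> and invert the second factor; closedness is
  openness of the resolvent set.\<close>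

lemma compact_cspectrum:
  fixes T :: "'a::chilbert \<Rightarrow> 'a"
  assumes T: "bounded_clinear T"
  shows "compact (cspectrum T)"
proof -
  obtain K where K: "K > 0" "\<And>x. norm (T x) \<le> norm x * K"
    by (rule bounded_clinear_pos[OF T]) (rule that)
  have "z \<notin> cspectrum T" if z: "cmod z > K" for z
  proof -
    define B where "B x = (1 / z) *\<^sub>C T x" for x
    have z0: "z \<noteq> 0" using z K by auto
    have bB: "bounded_clinear B" unfolding B_def by (rule bounded_clinear_scaleC[OF T])
    have nB: "norm (B x) \<le> (K / cmod z) * norm x" for x
      unfolding B_def norm_scaleC using mult_left_mono[OF K(2)[of x], of "1 / cmod z"]
      by (simp add: norm_divide mult.commute)
    have "cinvertible (\<lambda>x. x - B x)"
      by (rule cinvertible_perturbed_identity[OF bB _ _ nB]) (use z K(1) z0 in \<open>auto simp: divide_less_eq\<close>)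
    note inv = cinverse[OF this]
    let ?S = "cinverse (\<lambda>x. x - B x)"
    have shift: "z *\<^sub>C x - T x = z *\<^sub>C (x - B x)" for x
      using z0 by (simp add: B_def scaleC_diff_right scaleC_scaleC scaleC_one)
    show ?thesis
    proof (rule cresolvent_unique(1)[OF T bounded_clinear_scaleC[OF inv(1)]])
      show "(1 / z) *\<^sub>C ?S (z *\<^sub>C x - T x) = x" for x
        unfolding shift using z0 by (simp add: bounded_clinearD(2)[OF inv(1)] scaleC_scaleC scaleC_one inv)
      show "z *\<^sub>C ((1 / z) *\<^sub>C ?S x) - T ((1 / z) *\<^sub>C ?S x) = x" for x
        unfolding shift using z0 inv(3)[of x]
        by (simp add: bounded_clinearD(2)[OF bB] scaleC_scaleC scaleC_one scaleC_diff_right)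
    qed
  qed
  then have "cspectrum T \<subseteq> cball 0 K" by (force simp: not_less)
  moreover have "closed (cspectrum T)"
    using open_compl_cspectrum[OF T] by (simp add: closed_def)
  ultimately show ?thesis
    by (meson bounded_cball bounded_subset compact_eq_bounded_closed)
qed

lemma continuous_on_cresolvent:
  fixes T :: "'a::chilbert \<Rightarrow> 'a"
  assumes T: "bounded_clinear T"
  shows "continuous_on (- cspectrum T) (\<lambda>z. cresolvent T z x)"
proof (rule continuous_at_imp_continuous_on, rule ballI)
  fix z0 assume "z0 \<in> - cspectrum T"
  then have z0: "z0 \<notin> cspectrum T" by simp
  obtain r M where r: "r > 0" "\<And>z. cmod (z - z0) < r \<Longrightarrow> z \<notin> cspectrum T"
    and M: "\<And>z x. cmod (z - z0) < r \<Longrightarrow> norm (cresolvent T z x) \<le> M * norm x"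
    using cresolvent_nearby[OF T z0] by metis
  let ?y = "cresolvent T z0 x"
  have "((\<lambda>z. cresolvent T z x - ?y) \<longlongrightarrow> 0) (at z0)"
  proof (rule Lim_null_comparison)
    have "\<forall>\<^sub>F z in at z0. cmod (z - z0) < r"
      using r(1) unfolding eventually_at by (auto simp: dist_norm)
    then show "\<forall>\<^sub>F z in at z0. norm (cresolvent T z x - ?y) \<le> cmod (z0 - z) * (M * norm ?y)"
    proof (rule eventually_mono)
      fix z assume z: "cmod (z - z0) < r"
      show "norm (cresolvent T z x - ?y) \<le> cmod (z0 - z) * (M * norm ?y)"
        unfolding cresolvent_identity[OF T r(2)[OF z] z0] norm_scaleC
        by (rule mult_left_mono[OF M[OF z]]) simp
    qed
    show "((\<lambda>z. cmod (z0 - z) * (M * norm ?y)) \<longlongrightarrow> 0) (at z0)"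
      by (rule tendsto_eq_intros refl | simp)+
  qed
  then show "isCont (\<lambda>z. cresolvent T z x) z0"
    unfolding isCont_def by (simp add: LIM_zero_iff)
qed

text \<open>By the resolvent identity the difference quotient at \<open>z0\<close> is minus the
  resolvent at \<open>z\<close> applied to the fixed vector \<open>cresolvent T z0 x\<close>, paired
  with \<open>y\<close>. Pointwise continuity of the resolvent at that vector gives the
  limit.\<close>

lemma holomorphic_cinner_cresolvent:
  fixes T :: "'a::chilbert \<Rightarrow> 'a"
  assumes T: "bounded_clinear T"
  shows "(\<lambda>z. cinner (cresolvent T z x) y) holomorphic_on - cspectrum T"
  unfolding holomorphic_on_open[OF open_compl_cspectrum[OF T]]
proof
  fix z0 assume z0: "z0 \<in> - cspectrum T"
  let ?y = "cresolvent T z0 x"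
  have "\<forall>\<^sub>F z in at z0. z \<in> - cspectrum T"
    using open_compl_cspectrum[OF T] z0 by (rule eventually_at_in_open')
  then have ev: "\<forall>\<^sub>F z in at z0. - cinner (cresolvent T z ?y) y =
     (cinner (cresolvent T z x) y - cinner ?y y) / (z - z0)"
    using eventually_neq_at_within[of z0]
  proof eventually_elim
    case (elim z)
    have "cinner (cresolvent T z x) y - cinner ?y y = cinner (cresolvent T z x - ?y) y"
      by (simp only: cinner_diff_left)
    also have "\<dots> = (z0 - z) * cinner (cresolvent T z ?y) y"
      using elim(1) z0 by (subst cresolvent_identity[OF T]) (auto simp only: cinner_scaleC_left Compl_iff)
    finally have "cinner (cresolvent T z x) y - cinner ?y y = - cinner (cresolvent T z ?y) y * (z - z0)"
      by (simp add: algebra_simps)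
    then show ?case using elim(2) by (simp only: nonzero_mult_div_cancel_right right_minus_eq not_False_eq_True)
  qed
  have "isCont (\<lambda>z. cresolvent T z ?y) z0"
    using continuous_on_cresolvent[OF T] z0 open_compl_cspectrum[OF T]
    by (simp add: continuous_on_eq_continuous_at)
  then have "((\<lambda>z. - cinner (cresolvent T z ?y) y) \<longlongrightarrow> - cinner (cresolvent T z0 ?y) y) (at z0)"
    unfolding isCont_def by (intro tendsto_intros)
  then have "((\<lambda>z. (cinner (cresolvent T z x) y - cinner ?y y) / (z - z0))
      \<longlongrightarrow> - cinner (cresolvent T z0 ?y) y) (at z0)"
    by (rule Lim_transform_eventually[OF _ ev])
  then show "\<exists>f'. ((\<lambda>z. cinner (cresolvent T z x) y) has_field_derivative f') (at z0)"
    unfolding has_field_derivative_iff by blast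
qed

section \<open>Grid cycles\<close>

definition cycle_in :: "complex set \<Rightarrow> (real \<Rightarrow> complex) list \<Rightarrow> bool" where
  "cycle_in X \<Gamma> \<longleftrightarrow>
     (\<forall>\<gamma>\<in>set \<Gamma>. valid_path \<gamma> \<and> pathfinish \<gamma> = pathstart \<gamma> \<and> path_image \<gamma> \<subseteq> X)"

text \<open>The balance condition says that every vertex has as many outgoing as incoming edges once
  the path \<open>\<gamma>\<close> is regarded as an additional edge from \<open>a\<close> to \<open>b\<close>. So \<open>\<gamma>\<close> can be extended by an
  edge leaving \<open>b\<close>, unless it is already closed.\<close>
lemma balanced_edges_cycle_aux:
  fixes p :: "'v \<Rightarrow> complex"
  assumes "finite E" "card E = n"
    and "\<And>v. (\<Sum>e\<in>E. of_bool (fst e = v)) + of_bool (v = a)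
           = (\<Sum>e\<in>E. of_bool (snd e = v)) + (of_bool (v = b) :: int)"
    and "valid_path \<gamma>" "pathstart \<gamma> = p a" "pathfinish \<gamma> = p b" "path_image \<gamma> \<subseteq> X"
    and "\<And>e. e \<in> E \<Longrightarrow> closed_segment (p (fst e)) (p (snd e)) \<subseteq> X"
  shows "\<exists>\<Gamma>. cycle_in X \<Gamma> \<and>
     (\<forall>g. g contour_integrable_on \<gamma> \<longrightarrow>
          (\<forall>e\<in>E. g contour_integrable_on linepath (p (fst e)) (p (snd e))) \<longrightarrow>
       (\<Sum>c\<leftarrow>\<Gamma>. contour_integral c g) =
         contour_integral \<gamma> g + (\<Sum>e\<in>E. contour_integral (linepath (p (fst e)) (p (snd e))) g))"
  using assms
proof (induction n arbitrary: E a b \<gamma>)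
  case 0
  then have E: "E = {}" by simp
  have "a = b" using 0(3)[of a] by (simp add: E split: if_splits)
  then show ?case
    using 0 by (intro exI[of _ "[\<gamma>]"]) (simp add: E cycle_in_def)
next
  case (Suc n)
  note bal = Suc.prems(3)
  show ?case
  proof (cases "a = b")
    \<comment> \<open>A closed \<open>\<gamma>\<close> is stored as a finished cycle, and an
      arbitrary remaining edge starts the next one.\<close>
    case True
    obtain e where e: "e \<in> E" using Suc.prems(2) by (metis all_not_in_conv card.empty nat.distinct(1))
    have fin: "finite (E - {e})" and card: "card (E - {e}) = n"
      using Suc.prems(1,2) e by auto
    have bal': "(\<Sum>e\<in>E - {e}. of_bool (fst e = v)) + of_bool (v = fst e)
           = (\<Sum>e\<in>E - {e}. of_bool (snd e = v)) + (of_bool (v = snd e) :: int)" for v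
      using bal[of v] True by (simp add: sum.remove[OF Suc.prems(1) e] eq_commute[of v])
    obtain \<Gamma> where \<Gamma>: "cycle_in X \<Gamma>" "\<And>g. g contour_integrable_on linepath (p (fst e)) (p (snd e)) \<Longrightarrow>
          (\<forall>e\<in>E - {e}. g contour_integrable_on linepath (p (fst e)) (p (snd e))) \<Longrightarrow>
       (\<Sum>c\<leftarrow>\<Gamma>. contour_integral c g) = contour_integral (linepath (p (fst e)) (p (snd e))) g +
         (\<Sum>e\<in>E - {e}. contour_integral (linepath (p (fst e)) (p (snd e))) g)"
      using Suc.IH[OF fin card bal', of "linepath (p (fst e)) (p (snd e))"] Suc.prems(8) e by auto
    show ?thesis
    proof (intro exI[of _ "\<gamma> # \<Gamma>"] conjI allI impI)
      show "cycle_in X (\<gamma> # \<Gamma>)"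
        using \<Gamma>(1) Suc.prems True by (simp add: cycle_in_def)
      fix g assume "g contour_integrable_on \<gamma>"
        "\<forall>e\<in>E. g contour_integrable_on linepath (p (fst e)) (p (snd e))"
      then show "(\<Sum>c\<leftarrow>\<gamma> # \<Gamma>. contour_integral c g) =
         contour_integral \<gamma> g + (\<Sum>e\<in>E. contour_integral (linepath (p (fst e)) (p (snd e))) g)"
        using \<Gamma>(2)[of g] e by (simp add: sum.remove[OF Suc.prems(1) e])
    qed
  next
    case False
    \<comment> \<open>At \<open>v = b\<close> the additional edge counts on the incoming side only,
      so the edges leaving \<open>b\<close> outnumber those entering it by one.\<close>
    have "(\<Sum>e\<in>E. of_bool (fst e = b)) = (\<Sum>e\<in>E. of_bool (snd e = b)) + (1::int)"
      using bal[of b] False by simp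
    moreover have "(\<Sum>e\<in>E. of_bool (snd e = b)) \<ge> (0::int)" by (simp add: sum_nonneg)
    ultimately have "(\<Sum>e\<in>E. of_bool (fst e = b)) \<noteq> (0::int)" by linarith
    then obtain e where e: "e \<in> E" "fst e = b"
      by (metis (mono_tags, lifting) of_bool_eq(1) sum.neutral)
    have fin: "finite (E - {e})" and card: "card (E - {e}) = n"
      using Suc.prems(1,2) e by auto
    have bal': "(\<Sum>e\<in>E - {e}. of_bool (fst e = v)) + of_bool (v = a)
           = (\<Sum>e\<in>E - {e}. of_bool (snd e = v)) + (of_bool (v = snd e) :: int)" for v
      using bal[of v] e(2) by (simp add: sum.remove[OF Suc.prems(1) e(1)] eq_commute[of v])
    let ?l = "linepath (p b) (p (snd e))"
    have vp: "valid_path (\<gamma> +++ ?l)"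
      using Suc.prems by (intro valid_path_join) auto
    have im: "path_image (\<gamma> +++ ?l) \<subseteq> X"
      using Suc.prems(6,7) Suc.prems(8)[OF e(1)] e(2) by (subst path_image_join) auto
    obtain \<Gamma> where \<Gamma>: "cycle_in X \<Gamma>" "\<And>g. g contour_integrable_on \<gamma> +++ ?l \<Longrightarrow>
          (\<forall>e\<in>E - {e}. g contour_integrable_on linepath (p (fst e)) (p (snd e))) \<Longrightarrow>
       (\<Sum>c\<leftarrow>\<Gamma>. contour_integral c g) = contour_integral (\<gamma> +++ ?l) g +
         (\<Sum>e\<in>E - {e}. contour_integral (linepath (p (fst e)) (p (snd e))) g)"
      using Suc.IH[OF fin card bal' vp _ _ im] Suc.prems(5,8) by auto
    show ?thesis
    proof (intro exI[of _ \<Gamma>] conjI allI impI)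
      fix g assume g: "g contour_integrable_on \<gamma>"
        "\<forall>e\<in>E. g contour_integrable_on linepath (p (fst e)) (p (snd e))"
      have gl: "g contour_integrable_on ?l" using g e by auto
      then have "contour_integral (\<gamma> +++ ?l) g = contour_integral \<gamma> g + contour_integral ?l g"
        using g Suc.prems by (intro contour_integral_join) auto
      moreover have "g contour_integrable_on \<gamma> +++ ?l"
        using g gl Suc.prems by (intro contour_integrable_joinI) auto
      ultimately show "(\<Sum>c\<leftarrow>\<Gamma>. contour_integral c g) =
         contour_integral \<gamma> g + (\<Sum>e\<in>E. contour_integral (linepath (p (fst e)) (p (snd e))) g)"
        using \<Gamma>(2)[of g] e(2) g(2) by (simp add: sum.remove[OF Suc.prems(1) e(1)])
    qed (rule \<Gamma>(1))
  qed
qed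

text \<open>The induction is started with the constant path at a vertex: it is closed, so it leaves
  the balance condition unchanged, and its integrals vanish. This turns a set of edges into the list
  of closed paths that \<open>admissible_cycles\<close> asks for.\<close>

lemma balanced_edges_cycle:
  fixes p :: "'v \<Rightarrow> complex"
  assumes fin: "finite E"
    and bal: "\<And>v. (\<Sum>e\<in>E. of_bool (fst e = v)) = (\<Sum>e\<in>E. of_bool (snd e = v) :: int)"
    and seg: "\<And>e. e \<in> E \<Longrightarrow> closed_segment (p (fst e)) (p (snd e)) \<subseteq> X"
  obtains \<Gamma> where "cycle_in X \<Gamma>"
    "\<And>g. (\<And>e. e \<in> E \<Longrightarrow> g contour_integrable_on linepath (p (fst e)) (p (snd e))) \<Longrightarrow>
       (\<Sum>c\<leftarrow>\<Gamma>. contour_integral c g) = (\<Sum>e\<in>E. contour_integral (linepath (p (fst e)) (p (snd e))) g)"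
proof (cases "E = {}")
  case True
  then show ?thesis using that[of "[]"] by (simp add: cycle_in_def)
next
  case False
  then obtain e where e: "e \<in> E" by blast
  let ?a = "p (fst e)"
  have im: "path_image (linepath ?a ?a) \<subseteq> X" using seg[OF e] by auto
  obtain \<Gamma> where \<Gamma>: "cycle_in X \<Gamma>" "\<And>g. g contour_integrable_on linepath ?a ?a \<Longrightarrow>
      (\<forall>e\<in>E. g contour_integrable_on linepath (p (fst e)) (p (snd e))) \<Longrightarrow>
      (\<Sum>c\<leftarrow>\<Gamma>. contour_integral c g) = contour_integral (linepath ?a ?a) g +
        (\<Sum>e\<in>E. contour_integral (linepath (p (fst e)) (p (snd e))) g)"
    using balanced_edges_cycle_aux[OF fin refl, of "fst e" "fst e" "linepath ?a ?a" p X] bal seg im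
    by auto
  show ?thesis
    by (rule that[OF \<Gamma>(1)]) (use \<Gamma>(2) in \<open>simp add: contour_integrable_continuous_linepath\<close>)
qed

text \<open>Vertices carry integer indices so that the cancellation of common edges is decided on
  pairs of integers instead of complex numbers.\<close>

definition grid_point :: "real \<Rightarrow> int \<times> int \<Rightarrow> complex" where
  "grid_point d v = Complex (d * of_int (fst v)) (d * of_int (snd v))"

definition grid_square :: "real \<Rightarrow> int \<times> int \<Rightarrow> complex set" where
  "grid_square d q = cbox (grid_point d q) (grid_point d (fst q + 1, snd q + 1))"

text \<open>The edges run counterclockwise, so that two neighbouring squares traverse their common
  edge in opposite directions.\<close>

definition grid_boundary :: "int \<times> int \<Rightarrow> ((int \<times> int) \<times> (int \<times> int)) set" where
  "grid_boundary = (\<lambda>(i, j).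
     {((i, j), (i+1, j)), ((i+1, j), (i+1, j+1)), ((i+1, j+1), (i, j+1)), ((i, j+1), (i, j))})"

lemma finite_grid_boundary [simp]: "finite (grid_boundary q)"
  by (simp add: grid_boundary_def split: prod.split)

text \<open>A square lies to the left of its directed edges, so an edge determines its square. Hence
  a sum over all edges splits into sums over the squares.\<close>

lemma grid_boundary_unique:
  assumes "e \<in> grid_boundary q" "e \<in> grid_boundary q'"
  shows "q = q'"
  using assms by (cases q; cases q') (auto simp: grid_boundary_def)

text \<open>The square on the right of the edge; an uncancelled edge will avoid the compact set
  because this square does.\<close>

lemma grid_boundary_neighbour:
  assumes "e \<in> grid_boundary q"
  obtains q' where "prod.swap e \<in> grid_boundary q'"
proof -
  obtain i j where q: "q = (i, j)" by fastforce
  have "prod.swap e \<in> grid_boundary (i, j - 1) \<or> prod.swap e \<in> grid_boundary (i + 1, j) \<or>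
      prod.swap e \<in> grid_boundary (i, j + 1) \<or> prod.swap e \<in> grid_boundary (i - 1, j)"
    using assms by (auto simp: grid_boundary_def q)
  then show ?thesis using that by blast
qed

lemma sum_grid_boundary:
  "sum F (grid_boundary (i, j)) = F ((i, j), (i+1, j)) + F ((i+1, j), (i+1, j+1)) +
     F ((i+1, j+1), (i, j+1)) + (F ((i, j+1), (i, j)) :: 'a::ab_group_add)"
  by (simp add: grid_boundary_def)

lemma mem_grid_square:
  "z \<in> grid_square d (i, j) \<longleftrightarrow>
    d * i \<le> Re z \<and> Re z \<le> d * (i + 1) \<and> d * j \<le> Im z \<and> Im z \<le> d * (j + 1)"
  by (auto simp: grid_square_def in_cbox_complex_iff grid_point_def)

lemma grid_edge_subset_square:
  assumes "e \<in> grid_boundary q" "d \<ge> 0"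
  shows "closed_segment (grid_point d (fst e)) (grid_point d (snd e)) \<subseteq> grid_square d q"
proof (rule closed_segment_subset)
  obtain i j where q: "q = (i, j)" by fastforce
  show "grid_point d (fst e) \<in> grid_square d q" "grid_point d (snd e) \<in> grid_square d q"
    using assms by (auto simp: grid_boundary_def q mem_grid_square grid_point_def algebra_simps)
  show "convex (grid_square d q)" by (simp add: grid_square_def)
qed

text \<open>Reversal permutes the edges whose reverse is also present, so the sum of an
  antisymmetric function over them equals its own negative.\<close>

lemma sum_uncancelled_edges:
  fixes I :: "'v \<times> 'v \<Rightarrow> 'a::real_vector"
  assumes fin: "finite B" and anti: "\<And>e. I (prod.swap e) = - I e"
  shows "(\<Sum>e\<in>{e \<in> B. prod.swap e \<notin> B}. I e) = (\<Sum>e\<in>B. I e)"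
proof -
  let ?C = "{e \<in> B. prod.swap e \<in> B}"
  have "sum I ?C = sum (\<lambda>e. I (prod.swap e)) ?C"
    by (rule sum.reindex_bij_witness[of _ prod.swap prod.swap]) auto
  then have "sum I ?C = - sum I ?C"
    by (simp add: anti sum_negf)
  then have "2 *\<^sub>R sum I ?C = 0"
    unfolding scaleR_2 by (simp only: eq_neg_iff_add_eq_0)
  then have "sum I ?C = 0" by simp
  moreover have "sum I B = sum I {e \<in> B. prod.swap e \<notin> B} + sum I ?C"
    using fin by (subst sum.union_disjoint[symmetric]) (auto intro!: sum.cong)
  ultimately show ?thesis by simp
qed

lemma contour_integral_rectpath_grid:
  assumes g: "\<And>e. e \<in> grid_boundary q \<Longrightarrow>
      g contour_integrable_on linepath (grid_point d (fst e)) (grid_point d (snd e))"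
  shows "contour_integral (rectpath (grid_point d q) (grid_point d (fst q + 1, snd q + 1))) g =
    (\<Sum>e\<in>grid_boundary q. contour_integral (linepath (grid_point d (fst e)) (grid_point d (snd e))) g)"
proof -
  obtain i j where q: "q = (i, j)" by fastforce
  let ?a = "grid_point d (i, j)" and ?b = "grid_point d (i+1, j)"
    and ?c = "grid_point d (i+1, j+1)" and ?e = "grid_point d (i, j+1)"
  have rect: "rectpath ?a ?c = linepath ?a ?b +++ linepath ?b ?c +++ linepath ?c ?e +++ linepath ?e ?a"
    by (simp add: rectpath_def Let_def grid_point_def)
  have g': "g contour_integrable_on linepath ?a ?b" "g contour_integrable_on linepath ?b ?c"
    "g contour_integrable_on linepath ?c ?e" "g contour_integrable_on linepath ?e ?a"
    using g[of "((i, j), (i+1, j))"] g[of "((i+1, j), (i+1, j+1))"]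
      g[of "((i+1, j+1), (i, j+1))"] g[of "((i, j+1), (i, j))"]
    by (simp_all add: grid_boundary_def q)
  show ?thesis
    by (simp add: q sum_grid_boundary rect g' contour_integral_join contour_integrable_joinI
        valid_path_join)
qed

text \<open>Take all squares that meet \<open>K\<close> and discard the edges traversed in both
  directions. What remains is balanced and avoids \<open>K\<close>, and integrals over it equal sums
  of integrals over the rectangles. These vanish for functions holomorphic on \<open>U\<close>, and
  only the rectangle around a given interior point winds around it.\<close>

theorem grid_cycle:
  assumes K: "compact K" and U: "open U" and KU: "K \<subseteq> U"
  obtains \<Gamma> where "cycle_in (U - K) \<Gamma>"
    "\<And>h. h holomorphic_on U \<Longrightarrow> (\<Sum>\<gamma>\<leftarrow>\<Gamma>. contour_integral \<gamma> h) = 0"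
    "\<And>z. z \<in> K \<Longrightarrow> (\<Sum>\<gamma>\<leftarrow>\<Gamma>. winding_number \<gamma> z) = 1"
proof -
  obtain \<epsilon> where \<epsilon>: "\<epsilon> > 0" "(\<Union>x\<in>K. ball x \<epsilon>) \<subseteq> U"
    using compact_subset_open_imp_ball_epsilon_subset[OF K U KU] by blast
  \<comment> \<open>Two points of a square of side \<open>d\<close> are at distance at most
    \<open>2 * d\<close>, which must stay below \<open>\<epsilon>\<close> for a square meeting
    \<open>K\<close> to lie in \<open>U\<close>.\<close>
  define d where "d = \<epsilon> / 3"
  have d: "d > 0" using \<epsilon> by (simp add: d_def)
  define Q where "Q = {q. grid_square d q \<inter> K \<noteq> {}}"
  define B where "B = (\<Union>q\<in>Q. grid_boundary q)"
  define E where "E = {e \<in> B. prod.swap e \<notin> B}"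
  let ?p = "grid_point d"
  let ?I = "\<lambda>g e. contour_integral (linepath (?p (fst e)) (?p (snd e))) g"
  have sq_U: "grid_square d q \<subseteq> U" if "q \<in> Q" for q
  proof
    obtain i j where q: "q = (i, j)" by fastforce
    fix w assume w: "w \<in> grid_square d q"
    obtain z where z: "z \<in> K" "z \<in> grid_square d q" using \<open>q \<in> Q\<close> Q_def by blast
    have "\<bar>Re (z - w)\<bar> \<le> d" "\<bar>Im (z - w)\<bar> \<le> d"
      using w z(2) by (auto simp: q mem_grid_square algebra_simps abs_le_iff)
    then have "cmod (z - w) \<le> 2 * d"
      using cmod_le[of "z - w"] by linarith
    then have "w \<in> ball z \<epsilon>" using d by (simp add: dist_norm d_def)
    then show "w \<in> U" using \<epsilon>(2) z(1) by blast
  qed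
  have fin_Q: "finite Q"
  proof -
    obtain R where R: "\<And>z. z \<in> K \<Longrightarrow> cmod z \<le> R"
      using compact_imp_bounded[OF K] unfolding bounded_iff by blast
    \<comment> \<open>The extra 1 absorbs the upper corner index \<open>k + 1\<close> in the lower
      bound for \<open>k\<close>.\<close>
    define N where "N = \<lceil>R / d\<rceil> + 1"
    have "Q \<subseteq> {-N..N} \<times> {-N..N}"
    proof
      fix q assume "q \<in> Q"
      obtain i j where q: "q = (i, j)" by fastforce
      obtain z where z: "z \<in> K" "z \<in> grid_square d q" using \<open>q \<in> Q\<close> Q_def by blast
      have N: "R / d + 1 \<le> of_int N" by (simp add: N_def)
      have *: "- N \<le> k \<and> k \<le> N" if "d * k \<le> x" "x \<le> d * (k + 1)" "\<bar>x\<bar> \<le> R" for k :: int and x :: real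
      proof -
        have "d * k \<le> R" "d * (k + 1) \<ge> - R" using that by linarith+
        then have "of_int k \<le> R / d" "of_int k + 1 \<ge> - (R / d)"
          using d by (auto simp: field_simps)
        then have "of_int k \<le> (of_int N :: real)" "- of_int N \<le> (of_int k :: real)"
          using N by linarith+
        then show ?thesis by linarith
      qed
      have "\<bar>Re z\<bar> \<le> R" "\<bar>Im z\<bar> \<le> R"
        using R[OF z(1)] abs_Re_le_cmod[of z] abs_Im_le_cmod[of z] by linarith+
      then show "q \<in> {-N..N} \<times> {-N..N}"
        using z(2) *[of i "Re z"] *[of j "Im z"] by (auto simp: q mem_grid_square)
    qed
    then show ?thesis by (rule finite_subset) simp
  qed
  have fin_B: "finite B" unfolding B_def using fin_Q by simp
  then have fin_E: "finite E" unfolding E_def by simp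
  have sum_B: "(\<Sum>e\<in>B. F e) = (\<Sum>q\<in>Q. \<Sum>e\<in>grid_boundary q. F e)" for F :: "_ \<Rightarrow> complex"
    unfolding B_def by (rule sum.UNION_disjoint) (use fin_Q grid_boundary_unique in auto)
  have sum_B_real: "(\<Sum>e\<in>B. F e) = (\<Sum>q\<in>Q. \<Sum>e\<in>grid_boundary q. F e)" for F :: "_ \<Rightarrow> real"
    unfolding B_def by (rule sum.UNION_disjoint) (use fin_Q grid_boundary_unique in auto)
  have edge_B: "closed_segment (?p (fst e)) (?p (snd e)) \<subseteq> U" if "e \<in> B" for e
    using that grid_edge_subset_square[of e _ d] d sq_U unfolding B_def by fastforce
  \<comment> \<open>The edge also bounds the square on its other side. That square is not in
    \<open>Q\<close>, since otherwise the edge would cancel, so it misses \<open>K\<close>.\<close>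
  have edge_E: "closed_segment (?p (fst e)) (?p (snd e)) \<subseteq> U - K" if eE: "e \<in> E" for e
  proof -
    obtain q where q: "q \<in> Q" "e \<in> grid_boundary q" using eE by (auto simp: E_def B_def)
    obtain q' where q': "prod.swap e \<in> grid_boundary q'" using grid_boundary_neighbour[OF q(2)] .
    have "q' \<notin> Q" using that q' by (auto simp: E_def B_def)
    then have "grid_square d q' \<inter> K = {}" by (simp add: Q_def)
    moreover have "closed_segment (?p (fst e)) (?p (snd e)) \<subseteq> grid_square d q'"
      using grid_edge_subset_square[OF q', of d] d by (simp add: closed_segment_commute)
    ultimately show ?thesis using edge_B[of e] that by (auto simp: E_def)
  qed
  \<comment> \<open>The difference of the two indicators is antisymmetric under reversal, so
    cancellation reduces the balance to single squares. It is computed in the reals because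
    \<open>sum_uncancelled_edges\<close> works in a real vector space.\<close>
  have bal: "(\<Sum>e\<in>E. of_bool (fst e = v)) = (\<Sum>e\<in>E. of_bool (snd e = v) :: int)" for v
  proof -
    let ?F = "\<lambda>e. of_bool (fst e = v) - of_bool (snd e = v) :: real"
    have "(\<Sum>e\<in>E. ?F e) = (\<Sum>q\<in>Q. \<Sum>e\<in>grid_boundary q. ?F e)"
      unfolding E_def sum_B_real[symmetric] by (rule sum_uncancelled_edges[OF fin_B]) simp
    also have "\<dots> = 0"
    proof (rule sum.neutral, rule ballI)
      fix q :: "int \<times> int"
      show "(\<Sum>e\<in>grid_boundary q. ?F e) = 0"
        by (cases q) (simp add: sum_grid_boundary)
    qed
    finally have "real_of_int (\<Sum>e\<in>E. of_bool (fst e = v)) = real_of_int (\<Sum>e\<in>E. of_bool (snd e = v))"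
      by (simp add: sum_subtractf)
    then show ?thesis by (simp only: of_int_eq_iff)
  qed
  obtain \<Gamma> where \<Gamma>: "cycle_in (U - K) \<Gamma>"
    "\<And>g. (\<And>e. e \<in> E \<Longrightarrow> g contour_integrable_on linepath (?p (fst e)) (?p (snd e))) \<Longrightarrow>
       (\<Sum>c\<leftarrow>\<Gamma>. contour_integral c g) = (\<Sum>e\<in>E. ?I g e)"
    using balanced_edges_cycle[OF fin_E bal edge_E] by blast
  have rev: "?I g (prod.swap e) = - ?I g e" for g e
    using contour_integral_reversepath[of "linepath (?p (fst e)) (?p (snd e))" g] by simp
  have main: "(\<Sum>c\<leftarrow>\<Gamma>. contour_integral c g) =
      (\<Sum>q\<in>Q. contour_integral (rectpath (?p q) (?p (fst q + 1, snd q + 1))) g)"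
    if g: "\<And>e. e \<in> B \<Longrightarrow> g contour_integrable_on linepath (?p (fst e)) (?p (snd e))" for g
  proof -
    have "(\<Sum>c\<leftarrow>\<Gamma>. contour_integral c g) = (\<Sum>e\<in>E. ?I g e)"
      by (rule \<Gamma>(2)) (use g E_def in auto)
    also have "\<dots> = (\<Sum>e\<in>B. ?I g e)"
      unfolding E_def by (rule sum_uncancelled_edges[OF fin_B, of "?I g", OF rev])
    also have "\<dots> = (\<Sum>q\<in>Q. \<Sum>e\<in>grid_boundary q. ?I g e)"
      by (rule sum_B)
    also have "\<dots> = (\<Sum>q\<in>Q. contour_integral (rectpath (?p q) (?p (fst q + 1, snd q + 1))) g)"
      by (intro sum.cong refl contour_integral_rectpath_grid[symmetric] g) (auto simp: B_def)
    finally show ?thesis .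
  qed
  have corners: "Re (?p q) \<le> Re (?p (fst q + 1, snd q + 1))" "Im (?p q) \<le> Im (?p (fst q + 1, snd q + 1))" for q
    using d by (auto simp: grid_point_def)
  show ?thesis
  proof (rule that[OF \<Gamma>(1)])
    fix h assume h: "h holomorphic_on U"
    have "(\<Sum>c\<leftarrow>\<Gamma>. contour_integral c h) =
      (\<Sum>q\<in>Q. contour_integral (rectpath (?p q) (?p (fst q + 1, snd q + 1))) h)"
      using edge_B by (intro main contour_integrable_continuous_linepath)
        (meson h continuous_on_subset holomorphic_on_imp_continuous_on)
    also have "\<dots> = 0"
    proof (rule sum.neutral, rule ballI, rule contour_integral_unique)
      fix q assume "q \<in> Q"
      show "(h has_contour_integral 0) (rectpath (?p q) (?p (fst q + 1, snd q + 1)))"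
      proof (rule Cauchy_theorem_convex_simple)
        show "h holomorphic_on grid_square d q"
          using h sq_U[OF \<open>q \<in> Q\<close>] by (rule holomorphic_on_subset)
        show "path_image (rectpath (?p q) (?p (fst q + 1, snd q + 1))) \<subseteq> grid_square d q"
          unfolding grid_square_def by (rule path_image_rectpath_subset_cbox[OF corners])
      qed (auto simp: grid_square_def)
    qed
    finally show "(\<Sum>c\<leftarrow>\<Gamma>. contour_integral c h) = 0" .
  next
    \<comment> \<open>A point of an open square lies on no grid edge, so \<open>main\<close> applies
      to the kernel \<open>1 / (w - z)\<close>.\<close>
    have interior: "(\<Sum>c\<leftarrow>\<Gamma>. winding_number c z) = 1"
      if q0: "q0 \<in> Q" and z: "z \<in> box (?p q0) (?p (fst q0 + 1, snd q0 + 1))"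
        and z\<Gamma>: "\<forall>c\<in>set \<Gamma>. z \<notin> path_image c" for z q0
    proof -
      have other: "z \<notin> grid_square d q" if "q \<noteq> q0" for q
      proof
        assume zq: "z \<in> grid_square d q"
        obtain i j i' j' where q: "q = (i, j)" "q0 = (i', j')" by (metis surj_pair)
        have *: "k = k'" if "d * k \<le> x" "x \<le> d * (k + 1)" "d * k' < x" "x < d * (k' + 1)"
          for k k' :: int and x
        proof -
          have "d * k < d * (k' + 1)" "d * k' < d * (k + 1)" using that by linarith+
          then have "real_of_int k < k' + 1" "real_of_int k' < k + 1" using d by simp_all
          then show ?thesis by linarith
        qed
        show False
          using zq z *[of i "Re z" i'] *[of j "Im z" j'] \<open>q \<noteq> q0\<close>
          by (auto simp: q mem_grid_square in_box_complex_iff grid_point_def)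
      qed
      let ?k = "\<lambda>w. 1 / (w - z)"
      have seg: "z \<notin> closed_segment (?p (fst e)) (?p (snd e))" if eB: "e \<in> B" for e
      proof -
        obtain q where q: "q \<in> Q" "e \<in> grid_boundary q" using eB by (auto simp: B_def)
        show ?thesis
        proof (cases "q = q0")
          case True
          obtain i j where ij: "q = (i, j)" by fastforce
          show ?thesis
          proof
            assume "z \<in> closed_segment (?p (fst e)) (?p (snd e))"
            then show False
              using q(2) z True by (auto simp: grid_boundary_def ij in_box_complex_iff grid_point_def
                  closed_segment_same_Re closed_segment_same_Im)
          qed
        next
          case False
          then show ?thesis using other[OF False] grid_edge_subset_square[OF q(2) less_imp_le[OF d]] by blast
        qed
      qed
      have "2 * pi * \<i> * (\<Sum>c\<leftarrow>\<Gamma>. winding_number c z) = (\<Sum>c\<leftarrow>\<Gamma>. contour_integral c ?k)"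
        using z\<Gamma> \<Gamma>(1) unfolding cycle_in_def
        by (induction \<Gamma>) (auto simp: winding_number_valid_path algebra_simps)
      also have "\<dots> = (\<Sum>q\<in>Q. contour_integral (rectpath (?p q) (?p (fst q + 1, snd q + 1))) ?k)"
        using seg by (intro main contour_integrable_continuous_linepath continuous_on_inversediff) auto
      also have "\<dots> = (\<Sum>q\<in>Q. if q = q0 then 2 * pi * \<i> else 0)"
      proof (rule sum.cong[OF refl])
        fix q assume "q \<in> Q"
        let ?r = "rectpath (?p q) (?p (fst q + 1, snd q + 1))"
        have im: "z \<notin> path_image ?r"
        proof (cases "q = q0")
          case True
          then show ?thesis using path_image_rectpath_inter_box[OF corners[of q]] z by blast
        next
          case False
          then show ?thesis
            using other path_image_rectpath_subset_cbox[OF corners[of q]] unfolding grid_square_def by blast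
        qed
        have "winding_number ?r z = (if q = q0 then 1 else 0)"
          using z other[of q] winding_number_rectpath winding_number_rectpath_outside[OF corners]
          by (auto simp: grid_square_def)
        then show "contour_integral ?r ?k = (if q = q0 then 2 * pi * \<i> else 0)"
          using winding_number_valid_path[OF valid_path_rectpath im]
          by (auto simp: field_simps split: if_splits)
      qed
      also have "\<dots> = 2 * pi * \<i>" using fin_Q q0 by simp
      finally show ?thesis by simp
    qed
    \<comment> \<open>A point of \<open>K\<close> may lie on a cancelled edge, where the kernel is
      singular. The winding numbers are constant near \<open>z\<close>, so \<open>z\<close> is
      replaced by a nearby point \<open>z'\<close> of an open square in \<open>Q\<close>.\<close>
    fix z assume z: "z \<in> K"
    let ?S = "\<Inter>c\<in>set \<Gamma>. - path_image c"
    have "open ?S"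
      using \<Gamma>(1) unfolding cycle_in_def
      by (intro open_INT) (auto intro!: open_Compl closed_path_image valid_path_imp_path)
    moreover have "z \<in> ?S" using \<Gamma>(1) z by (auto simp: cycle_in_def)
    ultimately obtain r where r: "r > 0" "ball z r \<subseteq> ?S" by (meson open_contains_ball)
    define i j where "i = \<lfloor>Re z / d\<rfloor>" and "j = \<lfloor>Im z / d\<rfloor>"
    have fl: "d * \<lfloor>x / d\<rfloor> \<le> x" "x \<le> d * (\<lfloor>x / d\<rfloor> + 1)" for x
    proof -
      have "of_int \<lfloor>x / d\<rfloor> \<le> x / d" "x / d \<le> of_int \<lfloor>x / d\<rfloor> + 1" by linarith+
      then show  "d * \<lfloor>x / d\<rfloor> \<le> x" "x \<le> d * (\<lfloor>x / d\<rfloor> + 1)" 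
        unfolding pos_le_divide_eq[OF d] pos_divide_le_eq[OF d] by (simp_all only: mult.commute of_int_add of_int_1)
    qed
    have zsq: "z \<in> grid_square d (i, j)" using fl by (simp add: mem_grid_square i_def j_def)
    then have q0: "(i, j) \<in> Q" using z by (auto simp: Q_def)
    let ?box = "box (?p (i, j)) (?p (i + 1, j + 1))"
    have "?p (i, j) + (d / 2) *\<^sub>R (1 + \<i>) \<in> ?box"
      using d by (simp add: in_box_complex_iff grid_point_def algebra_simps)
    then have "closure ?box = grid_square d (i, j)"
      unfolding grid_square_def by (subst closure_box) auto
    then obtain z' where z': "z' \<in> ?box" "dist z' z < r"
      using zsq r(1) closure_approachable by blast
    have "z' \<in> ball z r" using z'(2) by (simp add: dist_commute)
    have "(\<Sum>c\<leftarrow>\<Gamma>. winding_number c z) = (\<Sum>c\<leftarrow>\<Gamma>. winding_number c z')"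
    proof (intro arg_cong[of _ _ sum_list] map_cong refl)
      fix c assume "c \<in> set \<Gamma>"
      then show "winding_number c z = winding_number c z'"
        using \<Gamma>(1) r \<open>z' \<in> ball z r\<close> unfolding cycle_in_def
        by (intro winding_number_eq[of c z "ball z r"]) (auto intro: valid_path_imp_path)
    qed
    also have "\<dots> = 1"
      using q0 z' r(2) \<open>z' \<in> ball z r\<close> by (intro interior[of "(i, j)"]) auto
    finally show "(\<Sum>c\<leftarrow>\<Gamma>. winding_number c z) = 1" .
  qed
qed

section \<open>Cauchy's theorem for cycles\<close>

text \<open>Exchanging two contour integrals requires paths with continuous derivative, which valid
  paths need not have. Polynomial paths do, and one close enough to \<open>\<gamma>\<close> gives
  the same integrals.\<close>

lemma polynomial_loop_approx:
  assumes W: "open W" and \<gamma>: "valid_path \<gamma>" "pathfinish \<gamma> = pathstart \<gamma>" "path_image \<gamma> \<subseteq> W"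
  obtains p where "polynomial_function p" "pathfinish p = pathstart p" "path_image p \<subseteq> W"
    "\<And>g. g holomorphic_on W \<Longrightarrow> contour_integral p g = contour_integral \<gamma> g"
proof -
  have path: "path \<gamma>" using \<gamma>(1) by (rule valid_path_imp_path)
  from contour_integral_nearby_ends[OF W path \<gamma>(3)]
  obtain d where d: "0 < d" and near: "\<forall>g h. valid_path g \<and> valid_path h \<and>
      (\<forall>t\<in>{0..1}. norm (g t - \<gamma> t) < d \<and> norm (h t - \<gamma> t) < d) \<and>
      pathstart h = pathstart g \<and> pathfinish h = pathfinish g \<longrightarrow>
      path_image g \<subseteq> W \<and> path_image h \<subseteq> W \<and>
      (\<forall>f. f holomorphic_on W \<longrightarrow> contour_integral h f = contour_integral g f)"
    by (elim exE conjE) (rule that)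
  obtain p where p: "polynomial_function p" "pathstart p = pathstart \<gamma>" "pathfinish p = pathfinish \<gamma>"
      "\<And>t. t \<in> {0..1} \<Longrightarrow> norm (p t - \<gamma> t) < d"
    using path_approx_polynomial_function[OF path d] by blast
  show ?thesis
    by (rule that[of p]) (use near[rule_format, of \<gamma> p] valid_path_polynomial_function[OF p(1)] p d \<gamma> in auto)
qed

lemma winding_number_cycle:
  assumes "cycle_in (- {z}) \<Gamma>"
  shows "2 * pi * \<i> * (\<Sum>\<gamma>\<leftarrow>\<Gamma>. winding_number \<gamma> z) = (\<Sum>\<gamma>\<leftarrow>\<Gamma>. contour_integral \<gamma> (\<lambda>w. 1 / (w - z)))"
  using assms unfolding cycle_in_def
  by (induction \<Gamma>) (auto simp: winding_number_valid_path algebra_simps)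

lemma cycle_in_mono: "cycle_in X \<Gamma> \<Longrightarrow> X \<subseteq> Y \<Longrightarrow> cycle_in Y \<Gamma>"
  by (auto simp: cycle_in_def)

text \<open>Winding numbers about points outside \<open>W\<close> are preserved because they are
  integrals of kernels holomorphic on \<open>W\<close>.\<close>

lemma polynomial_cycle_approx:
  assumes W: "open W" and \<Gamma>: "cycle_in W \<Gamma>"
  obtains \<Delta> where "cycle_in W \<Delta>" "\<forall>\<gamma>\<in>set \<Delta>. polynomial_function \<gamma>"
    "\<And>g. g holomorphic_on W \<Longrightarrow> (\<Sum>\<gamma>\<leftarrow>\<Delta>. contour_integral \<gamma> g) = (\<Sum>\<gamma>\<leftarrow>\<Gamma>. contour_integral \<gamma> g)"
    "\<And>z. z \<notin> W \<Longrightarrow> (\<Sum>\<gamma>\<leftarrow>\<Delta>. winding_number \<gamma> z) = (\<Sum>\<gamma>\<leftarrow>\<Gamma>. winding_number \<gamma> z)"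
proof -
  have "\<exists>p. \<gamma> \<in> set \<Gamma> \<longrightarrow> polynomial_function p \<and> pathfinish p = pathstart p \<and> path_image p \<subseteq> W \<and>
      (\<forall>g. g holomorphic_on W \<longrightarrow> contour_integral p g = contour_integral \<gamma> g)" for \<gamma>
  proof (cases "\<gamma> \<in> set \<Gamma>")
    case True
    then have "valid_path \<gamma>" "pathfinish \<gamma> = pathstart \<gamma>" "path_image \<gamma> \<subseteq> W"
      using \<Gamma> by (auto simp: cycle_in_def)
    from polynomial_loop_approx[OF W this] show ?thesis by metis
  qed blast
  then obtain P where P: "\<And>\<gamma>. \<gamma> \<in> set \<Gamma> \<Longrightarrow> polynomial_function (P \<gamma>) \<and> pathfinish (P \<gamma>) = pathstart (P \<gamma>) \<and>
      path_image (P \<gamma>) \<subseteq> W \<and> (\<forall>g. g holomorphic_on W \<longrightarrow> contour_integral (P \<gamma>) g = contour_integral \<gamma> g)"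
    by metis
  have cyc: "cycle_in W (map P \<Gamma>)"
    using P by (auto simp: cycle_in_def valid_path_polynomial_function)
  have int: "(\<Sum>\<gamma>\<leftarrow>map P \<Gamma>. contour_integral \<gamma> g) = (\<Sum>\<gamma>\<leftarrow>\<Gamma>. contour_integral \<gamma> g)"
    if "g holomorphic_on W" for g
    using P that by (auto simp: comp_def intro!: arg_cong[of _ _ sum_list])
  show ?thesis
  proof (rule that[OF cyc _ int])
    show "\<forall>\<gamma>\<in>set (map P \<Gamma>). polynomial_function \<gamma>" using P by auto
    fix z assume z: "z \<notin> W"
    have "(\<lambda>w. 1 / (w - z)) holomorphic_on W"
      using z by (intro holomorphic_intros) auto
    then have "(\<Sum>\<gamma>\<leftarrow>map P \<Gamma>. contour_integral \<gamma> (\<lambda>w. 1 / (w - z))) =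
        (\<Sum>\<gamma>\<leftarrow>\<Gamma>. contour_integral \<gamma> (\<lambda>w. 1 / (w - z)))" by (rule int)
    moreover have "cycle_in (- {z}) (map P \<Gamma>)" "cycle_in (- {z}) \<Gamma>"
      using z cyc \<Gamma> by (auto intro: cycle_in_mono[of W])
    ultimately have "2 * pi * \<i> * (\<Sum>\<gamma>\<leftarrow>map P \<Gamma>. winding_number \<gamma> z) =
        2 * pi * \<i> * (\<Sum>\<gamma>\<leftarrow>\<Gamma>. winding_number \<gamma> z)"
      by (simp only: winding_number_cycle)
    then show "(\<Sum>\<gamma>\<leftarrow>map P \<Gamma>. winding_number \<gamma> z) = (\<Sum>\<gamma>\<leftarrow>\<Gamma>. winding_number \<gamma> z)"
      by simp
  qed
qed

lemma continuous_vector_derivative_polynomial_function: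
  fixes \<gamma> :: "real \<Rightarrow> complex"
  assumes "polynomial_function \<gamma>"
  shows "continuous_on X (\<lambda>t. vector_derivative \<gamma> (at t))"
proof -
  obtain \<gamma>' where "polynomial_function \<gamma>'" "\<And>t. (\<gamma> has_vector_derivative \<gamma>' t) (at t)"
    using has_vector_derivative_polynomial_function[OF assms] by blast
  moreover from this have "(\<lambda>t. vector_derivative \<gamma> (at t)) = \<gamma>'"
    by (auto simp: vector_derivative_at)
  ultimately show ?thesis by (simp add: continuous_on_polymonial_function)
qed

lemma contour_integrable_continuous_polynomial_function:
  assumes \<gamma>: "polynomial_function \<gamma>" and f: "continuous_on (path_image \<gamma>) f"
  shows "f contour_integrable_on \<gamma>"
proof -
  have "continuous_on {0..1} (\<lambda>t. f (\<gamma> t))"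
    using continuous_on_compose2[OF f continuous_on_polymonial_function[OF \<gamma>, of "{0..1}"]]
    by (auto simp: path_image_def)
  then have "continuous_on {0..1} (\<lambda>t. f (\<gamma> t) * vector_derivative \<gamma> (at t))"
    by (intro continuous_intros continuous_vector_derivative_polynomial_function[OF \<gamma>])
  then show ?thesis
    by (simp add: contour_integrable_on integrable_continuous_real)
qed

text \<open>Makes the inner of two iterated contour integrals a continuous function, hence
  integrable along the outer path.\<close>

lemma continuous_on_contour_integral_param:
  fixes S :: "complex set"
  assumes \<gamma>: "polynomial_function \<gamma>"
    and F: "continuous_on (S \<times> path_image \<gamma>) (\<lambda>(z, w). F z w)"
  shows "continuous_on S (\<lambda>z. contour_integral \<gamma> (F z))"
proof -
  let ?\<phi> = "\<lambda>x::complex \<times> real. (fst x, \<gamma> (snd x))"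
  have "continuous_on (S \<times> {0..1}) ?\<phi>"
    by (intro continuous_intros continuous_on_compose2[OF continuous_on_polymonial_function[OF \<gamma>, of UNIV]]) auto
  then have "continuous_on (S \<times> {0..1}) (\<lambda>x. F (fst x) (\<gamma> (snd x)))"
    using continuous_on_compose2[OF F, of "S \<times> {0..1}" ?\<phi>]
    by (simp add: path_image_def split_beta image_subset_iff)
  moreover have "continuous_on (S \<times> {0..1}) (\<lambda>x::complex \<times> real. vector_derivative \<gamma> (at (snd x)))"
    by (intro continuous_on_compose2[OF continuous_vector_derivative_polynomial_function[OF \<gamma>, of UNIV]]
        continuous_intros) auto
  ultimately have "continuous_on (S \<times> {0..1}) (\<lambda>x. F (fst x) (\<gamma> (snd x)) * vector_derivative \<gamma> (at (snd x)))"
    by (intro continuous_intros)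
  then have "continuous_on (S \<times> cbox 0 1) (\<lambda>(z, t). F z (\<gamma> t) * vector_derivative \<gamma> (at t))"
    by (simp add: split_beta)
  then have "continuous_on S (\<lambda>z. integral (cbox 0 1) (\<lambda>t. F z (\<gamma> t) * vector_derivative \<gamma> (at t)))"
    by (rule integral_continuous_on_param)
  then show ?thesis by (simp add: contour_integral_integral)
qed

lemma contour_integral_sum_list:
  assumes "\<And>d. d \<in> set \<Delta> \<Longrightarrow> F d contour_integrable_on \<gamma>"
  shows "contour_integral \<gamma> (\<lambda>z. \<Sum>d\<leftarrow>\<Delta>. F d z) = (\<Sum>d\<leftarrow>\<Delta>. contour_integral \<gamma> (F d))"
proof -
  have "((\<lambda>z. \<Sum>d\<leftarrow>\<Delta>. F d z) has_contour_integral (\<Sum>d\<leftarrow>\<Delta>. contour_integral \<gamma> (F d))) \<gamma>"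
    using assms
    by (induction \<Delta>) (auto intro!: has_contour_integral_add has_contour_integral_integral has_contour_integral_0)
  then show ?thesis by (rule contour_integral_unique)
qed

lemma sum_list_swap:
  "(\<Sum>x\<leftarrow>xs. \<Sum>y\<leftarrow>ys. f x y) = (\<Sum>y\<leftarrow>ys. \<Sum>x\<leftarrow>xs. f x y :: 'a::comm_monoid_add)"
  by (induction xs) (simp_all add: sum_list_addf)

text \<open>The difference quotient of \<open>h\<close> at \<open>z\<close> has a removable
  singularity, so its integral vanishes by \<open>zero\<close>. The remaining term is
  \<open>h z\<close> times the integral of the kernel, that is, a winding number.\<close>

lemma Cauchy_formula_grid_cycle:
  assumes W: "open W" and h: "h holomorphic_on W" and z: "z \<in> W"
    and \<Delta>: "cycle_in (W - {z}) \<Delta>"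
    and zero: "\<And>h. h holomorphic_on W \<Longrightarrow> (\<Sum>\<delta>\<leftarrow>\<Delta>. contour_integral \<delta> h) = 0"
    and one: "(\<Sum>\<delta>\<leftarrow>\<Delta>. winding_number \<delta> z) = 1"
  shows "(\<Sum>\<delta>\<leftarrow>\<Delta>. contour_integral \<delta> (\<lambda>w. h w / (w - z))) = 2 * pi * \<i> * h z"
proof -
  define k where "k w = (if w = z then deriv h z else (h w - h z) / (w - z))" for w
  have "k holomorphic_on W" unfolding k_def by (rule pole_lemma_open[OF h W])
  then have k0: "(\<Sum>\<delta>\<leftarrow>\<Delta>. contour_integral \<delta> k) = 0" by (rule zero)
  have "contour_integral \<delta> (\<lambda>w. h w / (w - z)) =
      contour_integral \<delta> k + h z * contour_integral \<delta> (\<lambda>w. 1 / (w - z))" if "\<delta> \<in> set \<Delta>" for \<delta>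
  proof -
    have \<delta>: "valid_path \<delta>" "path_image \<delta> \<subseteq> W - {z}" using \<Delta> that by (auto simp: cycle_in_def)
    have hol: "k holomorphic_on W - {z}" "(\<lambda>w. 1 / (w - z)) holomorphic_on W - {z}"
      using \<open>k holomorphic_on W\<close> by (auto intro!: holomorphic_intros elim: holomorphic_on_subset)
    have int: "k contour_integrable_on \<delta>" "(\<lambda>w. 1 / (w - z)) contour_integrable_on \<delta>"
      using hol \<delta> W by (auto intro!: contour_integrable_holomorphic_simple[of _ "W - {z}"])
    have "contour_integral \<delta> (\<lambda>w. h w / (w - z)) = contour_integral \<delta> (\<lambda>w. k w + h z * (1 / (w - z)))"
      by (rule contour_integral_eq) (use \<delta> in \<open>auto simp: k_def diff_divide_distrib\<close>)
    then show ?thesis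
      by (simp only: contour_integral_add[OF int(1) contour_integrable_lmul[OF int(2)]]
          contour_integral_lmul[OF int(2)])
  qed
  then have "(\<Sum>\<delta>\<leftarrow>\<Delta>. contour_integral \<delta> (\<lambda>w. h w / (w - z))) =
      (\<Sum>\<delta>\<leftarrow>\<Delta>. contour_integral \<delta> k + h z * contour_integral \<delta> (\<lambda>w. 1 / (w - z)))"
    by (intro arg_cong[of _ _ sum_list] map_cong) auto
  also have "\<dots> = h z * (\<Sum>\<delta>\<leftarrow>\<Delta>. contour_integral \<delta> (\<lambda>w. 1 / (w - z)))"
    by (simp only: sum_list_addf k0 sum_list_const_mult add_0_left)
  also have "\<dots> = h z * (2 * pi * \<i>)"
    using winding_number_cycle[OF cycle_in_mono[OF \<Delta>, of "- {z}"]] one by auto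
  finally show ?thesis by simp
qed

text \<open>Enclose in a grid cycle \<open>\<Delta>\<close> the images of \<open>\<Gamma>\<close> and all points that \<open>\<Gamma>\<close> winds around, write \<open>h\<close> on \<open>\<Gamma>\<close> as a Cauchy integral over \<open>\<Delta>\<close>,
  and exchange the integrations; the inner integrals are winding numbers of \<open>\<Gamma>\<close> about points of
  \<open>\<Delta>\<close> and so cancel.\<close>
theorem Cauchy_theorem_cycle:
  assumes W: "open W" and h: "h holomorphic_on W" and \<Gamma>: "cycle_in W \<Gamma>"
    and zero: "\<And>z. z \<notin> W \<Longrightarrow> (\<Sum>\<gamma>\<leftarrow>\<Gamma>. winding_number \<gamma> z) = 0"
  shows "(\<Sum>\<gamma>\<leftarrow>\<Gamma>. contour_integral \<gamma> h) = 0"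
proof -
  obtain G where G: "cycle_in W G" "\<forall>\<gamma>\<in>set G. polynomial_function \<gamma>"
    "\<And>g. g holomorphic_on W \<Longrightarrow> (\<Sum>\<gamma>\<leftarrow>G. contour_integral \<gamma> g) = (\<Sum>\<gamma>\<leftarrow>\<Gamma>. contour_integral \<gamma> g)"
    "\<And>z. z \<notin> W \<Longrightarrow> (\<Sum>\<gamma>\<leftarrow>G. winding_number \<gamma> z) = (\<Sum>\<gamma>\<leftarrow>\<Gamma>. winding_number \<gamma> z)"
    using polynomial_cycle_approx[OF W \<Gamma>] by blast
  define I where "I = (\<Union>\<gamma>\<in>set G. path_image \<gamma>)"
  have path: "path \<gamma>" "pathfinish \<gamma> = pathstart \<gamma>" if "\<gamma> \<in> set G" for \<gamma>
    using that G(1) by (auto simp: cycle_in_def intro: valid_path_imp_path)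
  have "compact I" unfolding I_def by (intro compact_UN compact_path_image path) auto
  have "I \<subseteq> W" using G(1) by (auto simp: I_def cycle_in_def)
  let ?n = "\<lambda>z. \<Sum>\<gamma>\<leftarrow>G. winding_number \<gamma> z"
  define K where "K = I \<union> {z. ?n z \<noteq> 0}"
  \<comment> \<open>Off \<open>I\<close> the winding number is locally constant, so a point where it
    vanishes has a neighbourhood where it vanishes.\<close>
  have "open (- K)"
    unfolding open_contains_ball
  proof
    fix z assume z: "z \<in> - K"
    obtain r where r: "r > 0" "ball z r \<subseteq> - I"
      using z \<open>compact I\<close> unfolding K_def
      by (metis Compl_Un IntD1 compact_imp_closed open_Compl open_contains_ball)
    have const: "?n w = ?n z" if "w \<in> ball z r" for w
    proof (intro arg_cong[of _ _ sum_list] map_cong refl)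
      fix \<gamma> assume "\<gamma> \<in> set G"
      then show "winding_number \<gamma> w = winding_number \<gamma> z"
        using r that path by (intro winding_number_eq[of \<gamma> w "ball z r"]) (auto simp: I_def)
    qed
    have "?n z = 0" using z by (simp add: K_def)
    then have "ball z r \<subseteq> - K" using r(2) const unfolding K_def by fastforce
    then show "\<exists>e>0. ball z e \<subseteq> - K" using r(1) by blast
  qed
  moreover have "bounded K"
  proof -
    obtain R where R: "I \<subseteq> ball 0 R"
      using \<open>compact I\<close> by (meson bounded_subset_ballD compact_imp_bounded)
    have "?n z = 0" if "z \<notin> ball 0 R" for z
    proof -
      have "?n z = (\<Sum>\<gamma>\<leftarrow>G. 0)"
        using that R path
        by (intro arg_cong[of _ _ sum_list] map_cong refl winding_number_zero_outside[of _ "ball 0 R"])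
          (auto simp: I_def)
      then show ?thesis by simp
    qed
    then have "K \<subseteq> ball 0 R" using R unfolding K_def by blast
    then show ?thesis by (rule bounded_subset[OF bounded_ball])
  qed
  ultimately have "compact K" by (simp add: compact_eq_bounded_closed closed_def)
  \<comment> \<open>Here the homology condition enters: the cycle winds around no point outside
    \<open>W\<close>.\<close>
  have "K \<subseteq> W" using \<open>I \<subseteq> W\<close> G(4) zero unfolding K_def by force
  obtain \<Delta>0 where \<Delta>0: "cycle_in (W - K) \<Delta>0"
    "\<And>h. h holomorphic_on W \<Longrightarrow> (\<Sum>\<delta>\<leftarrow>\<Delta>0. contour_integral \<delta> h) = 0"
    "\<And>z. z \<in> K \<Longrightarrow> (\<Sum>\<delta>\<leftarrow>\<Delta>0. winding_number \<delta> z) = 1"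
    using grid_cycle[OF \<open>compact K\<close> W \<open>K \<subseteq> W\<close>] by blast
  have WK: "open (W - K)" using W \<open>compact K\<close> by (simp add: open_Diff compact_imp_closed)
  \<comment> \<open>Approximating inside \<open>W - K\<close>, and not merely inside
    \<open>W\<close>, keeps the winding numbers about points of \<open>K\<close> equal to 1.\<close>
  obtain \<Delta> where \<Delta>: "cycle_in (W - K) \<Delta>" "\<forall>\<delta>\<in>set \<Delta>. polynomial_function \<delta>"
    "\<And>g. g holomorphic_on W - K \<Longrightarrow> (\<Sum>\<delta>\<leftarrow>\<Delta>. contour_integral \<delta> g) = (\<Sum>\<delta>\<leftarrow>\<Delta>0. contour_integral \<delta> g)"
    "\<And>z. z \<notin> W - K \<Longrightarrow> (\<Sum>\<delta>\<leftarrow>\<Delta>. winding_number \<delta> z) = (\<Sum>\<delta>\<leftarrow>\<Delta>0. winding_number \<delta> z)"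
    using polynomial_cycle_approx[OF WK \<Delta>0(1)] by blast
  have formula: "(\<Sum>\<delta>\<leftarrow>\<Delta>. contour_integral \<delta> (\<lambda>w. h w / (w - z))) = 2 * pi * \<i> * h z" if "z \<in> K" for z
  proof (rule Cauchy_formula_grid_cycle[OF W h])
    show "(\<Sum>\<delta>\<leftarrow>\<Delta>. contour_integral \<delta> g) = 0" if "g holomorphic_on W" for g
      using \<Delta>(3)[of g] \<Delta>0(2)[OF that] holomorphic_on_subset[OF that] by auto
    show "(\<Sum>\<delta>\<leftarrow>\<Delta>. winding_number \<delta> z) = 1"
      using \<Delta>(4)[of z] \<Delta>0(3)[OF \<open>z \<in> K\<close>] \<open>z \<in> K\<close> by auto
  qed (use \<open>z \<in> K\<close> \<open>K \<subseteq> W\<close> \<Delta>(1) in \<open>auto intro: cycle_in_mono\<close>)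
  let ?F = "\<lambda>z w. h w / (w - z)"
  have im\<Delta>: "path_image \<delta> \<subseteq> W - K" if "\<delta> \<in> set \<Delta>" for \<delta> using \<Delta>(1) that by (auto simp: cycle_in_def)
  have im\<Gamma>: "path_image \<gamma> \<subseteq> I" if "\<gamma> \<in> set G" for \<gamma> using that by (auto simp: I_def)
  have "I \<subseteq> K" by (auto simp: K_def)
  have cont: "continuous_on (I \<times> (W - K)) (\<lambda>(z, w). ?F z w)"
    using \<open>I \<subseteq> K\<close> unfolding split_beta
    by (intro continuous_intros continuous_on_compose2[OF holomorphic_on_imp_continuous_on[OF h]]) auto
  have cont': "continuous_on ((W - K) \<times> I) (\<lambda>(w, z). ?F z w)"
    using \<open>I \<subseteq> K\<close> unfolding split_beta
    by (intro continuous_intros continuous_on_compose2[OF holomorphic_on_imp_continuous_on[OF h]]) auto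
  have int1: "(\<lambda>z. contour_integral \<delta> (?F z)) contour_integrable_on \<gamma>"
    if "\<delta> \<in> set \<Delta>" "\<gamma> \<in> set G" for \<delta> \<gamma>
    using that \<Delta>(2) G(2) im\<Delta>[OF that(1)] im\<Gamma>[OF that(2)]
    by (intro contour_integrable_continuous_polynomial_function continuous_on_contour_integral_param
        continuous_on_subset[OF cont]) auto
  have int2: "(\<lambda>w. contour_integral \<gamma> (\<lambda>z. ?F z w)) contour_integrable_on \<delta>"
    if "\<delta> \<in> set \<Delta>" "\<gamma> \<in> set G" for \<delta> \<gamma>
    using that \<Delta>(2) G(2) im\<Delta>[OF that(1)] im\<Gamma>[OF that(2)]
    by (intro contour_integrable_continuous_polynomial_function continuous_on_contour_integral_param
        continuous_on_subset[OF cont']) auto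
  have swap: "contour_integral \<gamma> (\<lambda>z. contour_integral \<delta> (?F z)) =
      contour_integral \<delta> (\<lambda>w. contour_integral \<gamma> (\<lambda>z. ?F z w))"
    if "\<delta> \<in> set \<Delta>" "\<gamma> \<in> set G" for \<delta> \<gamma>
    using that \<Delta>(2) G(2) im\<Delta>[OF that(1)] im\<Gamma>[OF that(2)]
    by (intro contour_integral_swap continuous_on_subset[OF cont] valid_path_polynomial_function
        continuous_vector_derivative_polynomial_function) auto
  have inner: "(\<Sum>\<gamma>\<leftarrow>G. contour_integral \<gamma> (\<lambda>z. ?F z w)) = 0" if w: "w \<in> W - K" for w
  proof -
    have "(\<Sum>\<gamma>\<leftarrow>G. contour_integral \<gamma> (\<lambda>z. ?F z w)) = (\<Sum>\<gamma>\<leftarrow>G. - h w * contour_integral \<gamma> (\<lambda>z. 1 / (z - w)))"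
    proof (intro arg_cong[of _ _ sum_list] map_cong refl)
      fix \<gamma> assume \<gamma>: "\<gamma> \<in> set G"
      have "contour_integral \<gamma> (\<lambda>z. ?F z w) = contour_integral \<gamma> (\<lambda>z. - h w * (1 / (z - w)))"
        by (rule contour_integral_eq) (simp add: minus_divide_right)
      also have "\<dots> = - h w * contour_integral \<gamma> (\<lambda>z. 1 / (z - w))"
      proof (rule contour_integral_lmul)
        have "w \<notin> path_image \<gamma>" using w \<open>I \<subseteq> K\<close> im\<Gamma>[OF \<gamma>] by auto
        then show "(\<lambda>z. 1 / (z - w)) contour_integrable_on \<gamma>"
          using G(2) \<gamma> by (intro contour_integrable_continuous_polynomial_function continuous_on_inversediff) auto
      qed
      finally show "contour_integral \<gamma> (\<lambda>z. ?F z w) = - h w * contour_integral \<gamma> (\<lambda>z. 1 / (z - w))" .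
    qed
    also have "\<dots> = - h w * (2 * pi * \<i> * ?n w)"
    proof -
      have "cycle_in (- {w}) G"
        using G(1) w im\<Gamma> \<open>I \<subseteq> K\<close> by (fastforce simp: cycle_in_def)
      then show ?thesis by (simp only: sum_list_const_mult winding_number_cycle)
    qed
    also have "?n w = 0" using w by (simp add: K_def)
    finally show ?thesis by simp
  qed
  have "2 * pi * \<i> * (\<Sum>\<gamma>\<leftarrow>G. contour_integral \<gamma> h) = (\<Sum>\<gamma>\<leftarrow>G. \<Sum>\<delta>\<leftarrow>\<Delta>. contour_integral \<gamma> (\<lambda>z. contour_integral \<delta> (?F z)))"
    unfolding sum_list_const_mult[symmetric]
  proof (intro arg_cong[of _ _ sum_list] map_cong refl)
    fix \<gamma> assume \<gamma>: "\<gamma> \<in> set G"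
    have "2 * pi * \<i> * contour_integral \<gamma> h = contour_integral \<gamma> (\<lambda>z. 2 * pi * \<i> * h z)"
      using G(2) \<gamma> im\<Gamma>[OF \<gamma>] \<open>I \<subseteq> W\<close>
      by (intro contour_integral_lmul[symmetric] contour_integrable_continuous_polynomial_function
          continuous_on_subset[OF holomorphic_on_imp_continuous_on[OF h]]) auto
    also have "\<dots> = contour_integral \<gamma> (\<lambda>z. \<Sum>\<delta>\<leftarrow>\<Delta>. contour_integral \<delta> (?F z))"
      using im\<Gamma>[OF \<gamma>] \<open>I \<subseteq> K\<close> by (intro contour_integral_eq formula[symmetric]) auto
    also have "\<dots> = (\<Sum>\<delta>\<leftarrow>\<Delta>. contour_integral \<gamma> (\<lambda>z. contour_integral \<delta> (?F z)))"
      by (rule contour_integral_sum_list[OF int1[OF _ \<gamma>]])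
    finally show "2 * pi * \<i> * contour_integral \<gamma> h = (\<Sum>\<delta>\<leftarrow>\<Delta>. contour_integral \<gamma> (\<lambda>z. contour_integral \<delta> (?F z)))" .
  qed
  also have "\<dots> = (\<Sum>\<delta>\<leftarrow>\<Delta>. \<Sum>\<gamma>\<leftarrow>G. contour_integral \<gamma> (\<lambda>z. contour_integral \<delta> (?F z)))"
    by (rule sum_list_swap)
  also have "\<dots> = (\<Sum>\<delta>\<leftarrow>\<Delta>. 0)"
  proof (intro arg_cong[of _ _ sum_list] map_cong refl)
    fix \<delta> assume \<delta>: "\<delta> \<in> set \<Delta>"
    have "(\<Sum>\<gamma>\<leftarrow>G. contour_integral \<gamma> (\<lambda>z. contour_integral \<delta> (?F z))) =
       (\<Sum>\<gamma>\<leftarrow>G. contour_integral \<delta> (\<lambda>w. contour_integral \<gamma> (\<lambda>z. ?F z w)))"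
      by (intro arg_cong[of _ _ sum_list] map_cong refl swap[OF \<delta>])
    also have "\<dots> = contour_integral \<delta> (\<lambda>w. \<Sum>\<gamma>\<leftarrow>G. contour_integral \<gamma> (\<lambda>z. ?F z w))"
      by (rule contour_integral_sum_list[symmetric, OF int2[OF \<delta>]])
    also have "\<dots> = 0"
      using im\<Delta>[OF \<delta>] inner by (intro contour_integral_eq_0) auto
    finally show "(\<Sum>\<gamma>\<leftarrow>G. contour_integral \<gamma> (\<lambda>z. contour_integral \<delta> (?F z))) = 0" .
  qed
  finally have "(\<Sum>\<gamma>\<leftarrow>G. contour_integral \<gamma> h) = 0" by (simp add: sum_list_0)
  then show ?thesis using G(3)[OF h] by simp
qed

section \<open>Existence and independence of admissible cycles\<close>

lemma admissible_cycles_exist: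
  assumes "compact S" "open U" "S \<subseteq> U"
  obtains \<Gamma> where "admissible_cycles U S \<Gamma>"
proof -
  obtain \<Gamma> where \<Gamma>: "cycle_in (U - S) \<Gamma>"
    "\<And>h. h holomorphic_on U \<Longrightarrow> (\<Sum>\<gamma>\<leftarrow>\<Gamma>. contour_integral \<gamma> h) = 0"
    "\<And>z. z \<in> S \<Longrightarrow> (\<Sum>\<gamma>\<leftarrow>\<Gamma>. winding_number \<gamma> z) = 1"
    using grid_cycle[OF assms] by blast
  \<comment> \<open>For \<open>z\<close> outside \<open>U\<close> the kernel is holomorphic on all
    of \<open>U\<close>, so its integral over the grid cycle vanishes.\<close>
  have "(\<Sum>\<gamma>\<leftarrow>\<Gamma>. winding_number \<gamma> z) = 0" if z: "z \<notin> U" for z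
  proof -
    have "(\<lambda>w. 1 / (w - z)) holomorphic_on U" using z by (intro holomorphic_intros) auto
    from \<Gamma>(2)[OF this] show ?thesis
      using winding_number_cycle[OF cycle_in_mono[OF \<Gamma>(1), of "- {z}"]] z by auto
  qed
  then have "admissible_cycles U S \<Gamma>"
    using \<Gamma> by (auto simp: admissible_cycles_def cycle_in_def)
  then show ?thesis by (rule that)
qed

text \<open>Allows one cycle around a larger set to serve several operators, whose calculi can then
  be compared under the same integral.\<close>

lemma admissible_cycles_subset:
  "admissible_cycles U S \<Gamma> \<Longrightarrow> S' \<subseteq> S \<Longrightarrow> admissible_cycles U S' \<Gamma>"
  by (auto simp: admissible_cycles_def)

lemma admissible_cycles_in: "admissible_cycles U S \<Gamma> \<Longrightarrow> cycle_in (U - S) \<Gamma>"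
  by (auto simp: admissible_cycles_def cycle_in_def)

lemma admissible_cycles_zero:
  assumes "open U" "admissible_cycles U S \<Gamma>" "h holomorphic_on U"
  shows "(\<Sum>\<gamma>\<leftarrow>\<Gamma>. contour_integral \<gamma> h) = 0"
  using assms cycle_in_mono[OF admissible_cycles_in[OF assms(2)], of U]
  by (intro Cauchy_theorem_cycle[of U]) (auto simp: admissible_cycles_def)

text \<open>The first cycle followed by the reversed second one winds 1 - 1 times around points of
  \<open>S\<close> and 0 times around points outside \<open>U\<close>, so Cauchy's theorem applies
  to it in \<open>U - S\<close>.\<close>

lemma admissible_cycles_independent:
  assumes U: "open U" and S: "closed S" and \<Gamma>: "admissible_cycles U S \<Gamma>" "admissible_cycles U S \<Gamma>'"
    and h: "h holomorphic_on U - S"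
  shows "(\<Sum>\<gamma>\<leftarrow>\<Gamma>. contour_integral \<gamma> h) = (\<Sum>\<gamma>\<leftarrow>\<Gamma>'. contour_integral \<gamma> h)"
proof -
  let ?\<Delta> = "\<Gamma> @ map reversepath \<Gamma>'"
  note cyc = admissible_cycles_in[OF \<Gamma>(1)] admissible_cycles_in[OF \<Gamma>(2)]
  have rev: "(\<Sum>\<gamma>\<leftarrow>map reversepath \<Gamma>'. contour_integral \<gamma> h) = - (\<Sum>\<gamma>\<leftarrow>\<Gamma>'. contour_integral \<gamma> h)"
    using cyc(2) unfolding cycle_in_def by (induction \<Gamma>') (auto simp: contour_integral_reversepath)
  have revw: "(\<Sum>\<gamma>\<leftarrow>map reversepath \<Gamma>'. winding_number \<gamma> z) = - (\<Sum>\<gamma>\<leftarrow>\<Gamma>'. winding_number \<gamma> z)"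
    if z: "z \<notin> U - S" for z
  proof -
    have "cycle_in (- {z}) \<Gamma>'" using cyc(2) z by (auto elim: cycle_in_mono)
    then show ?thesis
      unfolding cycle_in_def
      by (induction \<Gamma>') (auto simp: winding_number_reversepath valid_path_imp_path)
  qed
  have "(\<Sum>\<gamma>\<leftarrow>?\<Delta>. contour_integral \<gamma> h) = 0"
  proof (rule Cauchy_theorem_cycle[OF _ h])
    show "open (U - S)" using U S by (rule open_Diff)
    show "cycle_in (U - S) ?\<Delta>" using cyc by (simp add: cycle_in_def ball_Un)
    show "(\<Sum>\<gamma>\<leftarrow>?\<Delta>. winding_number \<gamma> z) = 0" if "z \<notin> U - S" for z
    proof (cases "z \<in> S")
      case True
      then show ?thesis using revw[OF that] \<Gamma> by (simp add: admissible_cycles_def)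
    next
      case False
      then have "z \<notin> U" using that by blast
      then show ?thesis using revw[OF that] \<Gamma> by (simp add: admissible_cycles_def)
    qed
  qed
  then show ?thesis using rev by simp
qed

section \<open>The Riesz functional calculus\<close>

definition segment_integral :: "(complex \<Rightarrow> 'a::chilbert) \<Rightarrow> complex \<Rightarrow> complex \<Rightarrow> 'a" where
  "segment_integral g a b = integral {0..1} (\<lambda>s. (b - a) *\<^sub>C g (linepath a b s))"

lemma segment_integrable:
  fixes g :: "complex \<Rightarrow> 'a::chilbert"
  assumes "continuous_on (closed_segment a b) g"
  shows "(\<lambda>s. (b - a) *\<^sub>C g (linepath a b s)) integrable_on {0..1}"
proof (rule integrable_continuous_real)
  have "continuous_on {0..1} (\<lambda>s. g (linepath a b s))"
    by (rule continuous_on_compose2[OF assms])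
      (auto simp: path_image_def simp flip: path_image_linepath intro!: continuous_intros)
  then show "continuous_on {0..1} (\<lambda>s. (b - a) *\<^sub>C g (linepath a b s))"
    by (intro continuous_intros)
qed

lemma cinner_segment_integral:
  fixes g :: "complex \<Rightarrow> 'a::chilbert"
  assumes "continuous_on (closed_segment a b) g"
  shows "cinner (segment_integral g a b) y = contour_integral (linepath a b) (\<lambda>z. cinner (g z) y)"
proof -
  have "((\<lambda>s. (b - a) *\<^sub>C g (linepath a b s)) has_integral segment_integral g a b) {0..1}"
    unfolding segment_integral_def by (rule integrable_integral[OF segment_integrable[OF assms]])
  then have "((\<lambda>x. cinner x y) \<circ> (\<lambda>s. (b - a) *\<^sub>C g (linepath a b s)) has_integral
      cinner (segment_integral g a b) y) {0..1}"
    by (rule has_integral_linear[OF _ bounded_linear_cinner_left])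
  then have "((\<lambda>z. cinner (g z) y) has_contour_integral cinner (segment_integral g a b) y) (linepath a b)"
    by (simp add: has_contour_integral_linepath comp_def cinner_scaleC_left mult.commute)
  then show ?thesis by (simp add: contour_integral_unique)
qed

text \<open>Vector-valued Cauchy theory is reduced to the scalar one by testing against all \<open>y\<close>.\<close>
lemma weakly_holomorphic_primitive:
  fixes g :: "complex \<Rightarrow> 'a::chilbert"
  assumes cont: "continuous_on (ball z0 r) g"
    and hol: "\<And>y. (\<lambda>z. cinner (g z) y) holomorphic_on ball z0 r"
  obtains G where "\<And>w. w \<in> ball z0 r \<Longrightarrow> (G has_derivative (\<lambda>h. h *\<^sub>C g w)) (at w)"
proof (cases "r > 0")
  case False
  then have "ball z0 r = {}" by simp
  then show ?thesis by (intro that[of "\<lambda>_. 0"]) (simp only: empty_iff)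
next
  case True
  define G where "G = segment_integral g z0"
  have cont_seg: "continuous_on (closed_segment a b) g" if "a \<in> ball z0 r" "b \<in> ball z0 r" for a b
    using that by (intro continuous_on_subset[OF cont] closed_segment_subset) auto
  \<comment> \<open>Path independence is checked after pairing with each \<open>y\<close>, where the
    scalar function has a primitive on the ball.\<close>
  have diff: "G z - G w = segment_integral g w z" if z: "z \<in> ball z0 r" and w: "w \<in> ball z0 r" for z w
  proof (rule cinner_eqI)
    fix y
    obtain H where H: "\<And>x. x \<in> ball z0 r \<Longrightarrow> (H has_field_derivative cinner (g x) y) (at x within ball z0 r)"
      using holomorphic_convex_primitive'[OF convex_ball open_ball hol[of y]] by blast
    have int: "contour_integral (linepath a b) (\<lambda>z. cinner (g z) y) = H b - H a"
      if "a \<in> ball z0 r" "b \<in> ball z0 r" for a b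
      using contour_integral_primitive[OF H, of "linepath a b"] closed_segment_subset[OF that convex_ball]
      by (simp add: contour_integral_unique)
    show "cinner (G z - G w) y = cinner (segment_integral g w z) y"
      unfolding cinner_diff_left G_def using True z w
      by (subst (1 2 3) cinner_segment_integral) (auto simp: int intro!: cont_seg)
  qed
  show ?thesis
  proof (rule that[of G])
    fix w assume w: "w \<in> ball z0 r"
    show "(G has_derivative (\<lambda>h. h *\<^sub>C g w)) (at w)"
      unfolding has_derivative_at_alt
    proof (intro conjI allI impI)
      show "bounded_linear (\<lambda>h. h *\<^sub>C g w)"
        by (rule bounded_bilinear.bounded_linear_left[OF bounded_bilinear_scaleC])
      fix e :: real assume "e > 0"
      have "isCont g w" using cont w by (simp add: continuous_on_eq_continuous_at)
      then obtain d where d: "d > 0" "\<And>z. dist z w < d \<Longrightarrow> dist (g z) (g w) < e"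
        using \<open>e > 0\<close> unfolding continuous_at_eps_delta by blast
      obtain d' where d': "d' > 0" "ball w d' \<subseteq> ball z0 r" using w open_contains_ball_eq[OF open_ball] by blast
      show "\<exists>d>0. \<forall>z. norm (z - w) < d \<longrightarrow> norm (G z - G w - (z - w) *\<^sub>C g w) \<le> e * norm (z - w)"
      proof (intro exI[of _ "min d d'"] conjI allI impI)
        fix z assume z: "norm (z - w) < min d d'"
        then have zb: "z \<in> ball z0 r" using d' by (auto simp: dist_norm norm_minus_commute)
        have int: "(\<lambda>s. (z - w) *\<^sub>C g (linepath w z s)) integrable_on {0..1}"
          by (rule segment_integrable[OF cont_seg[OF w zb]])
        have "G z - G w - (z - w) *\<^sub>C g w =
            integral {0..1} (\<lambda>s. (z - w) *\<^sub>C g (linepath w z s) - (z - w) *\<^sub>C g w)"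
          using diff[OF zb w] int by (simp add: segment_integral_def integral_diff integrable_const_ivl)
        also have "norm \<dots> \<le> (e * norm (z - w)) * (1 - 0)"
        proof (rule integral_bound)
          show "continuous_on {0..1} (\<lambda>s. (z - w) *\<^sub>C g (linepath w z s) - (z - w) *\<^sub>C g w)"
            using cont_seg[OF w zb]
            by (intro continuous_intros continuous_on_compose2[OF cont_seg[OF w zb]])
              (auto simp: path_image_def simp flip: path_image_linepath)
          fix s :: real assume s: "s \<in> {0..1}"
          have "linepath w z s \<in> closed_segment w z"
            using s by (metis imageI path_image_def path_image_linepath)
          then have "dist (linepath w z s) w \<le> dist z w"
            using dist_in_closed_segment(1)[of "linepath w z s" w z] by (simp add: dist_commute)
          then have "dist (g (linepath w z s)) (g w) < e" using z by (intro d(2)) (simp add: dist_norm)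
          then show "norm ((z - w) *\<^sub>C g (linepath w z s) - (z - w) *\<^sub>C g w) \<le> e * norm (z - w)"
            unfolding scaleC_diff_right[symmetric] norm_scaleC
            by (metis dist_norm less_imp_le mult.commute mult_left_mono norm_ge_zero)
        qed simp
        finally show "norm (G z - G w - (z - w) *\<^sub>C g w) \<le> e * norm (z - w)" by simp
      qed (use d d' in auto)
    qed
  qed
qed

text \<open>Since a valid path may have an unbounded derivative, continuity of \<open>g\<close> does not suffice here.\<close>
lemma contour_integrable_weakly_holomorphic:
  fixes g :: "complex \<Rightarrow> 'a::chilbert"
  assumes W: "open W" and cont: "continuous_on W g"
    and hol: "\<And>y. (\<lambda>z. cinner (g z) y) holomorphic_on W"
    and \<gamma>: "valid_path \<gamma>" "path_image \<gamma> \<subseteq> W"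
  shows "(\<lambda>t. vector_derivative \<gamma> (at t within {0..1}) *\<^sub>C g (\<gamma> t)) integrable_on {0..1}"
proof -
  obtain E where E: "finite E" "\<gamma> C1_differentiable_on ({0..1} - E)" and cont\<gamma>: "continuous_on {0..1} \<gamma>"
    using \<gamma>(1) unfolding valid_path_def piecewise_C1_differentiable_on_def by blast
  \<comment> \<open>Near each parameter the path stays in a ball where \<open>g\<close> has a
    primitive \<open>G\<close>. The fundamental theorem for \<open>G \<circ> \<gamma>\<close>
    tolerates the finitely many bad parameters and yields integrability with no bound on the
    derivative; the local pieces are then joined.\<close>
  have "\<exists>d>0. \<forall>u v. t \<in> cbox u v \<and> cbox u v \<subseteq> ball t d \<and> cbox u v \<subseteq> cbox 0 1 \<longrightarrow>
      (\<lambda>t. vector_derivative \<gamma> (at t within {0..1}) *\<^sub>C g (\<gamma> t)) integrable_on cbox u v"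
    if t: "t \<in> cbox 0 1" for t
  proof -
    have "\<gamma> t \<in> W" using t \<gamma>(2) by (auto simp: path_image_def)
    then obtain r where r: "r > 0" "ball (\<gamma> t) r \<subseteq> W" using W by (meson open_contains_ball)
    obtain G where G: "\<And>w. w \<in> ball (\<gamma> t) r \<Longrightarrow> (G has_derivative (\<lambda>h. h *\<^sub>C g w)) (at w)"
      using weakly_holomorphic_primitive[OF continuous_on_subset[OF cont r(2)] holomorphic_on_subset[OF hol r(2)]]
      by blast
    obtain d where d: "d > 0" "\<And>s. s \<in> {0..1} \<Longrightarrow> dist s t < d \<Longrightarrow> dist (\<gamma> s) (\<gamma> t) < r"
      using cont\<gamma> t r(1) unfolding continuous_on_iff by (metis box_real(2))
    show ?thesis
    proof (intro exI[of _ d] conjI allI impI d(1))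
      fix u v assume *: "t \<in> cbox u v \<and> cbox u v \<subseteq> ball t d \<and> cbox u v \<subseteq> cbox 0 1"
      then have uv: "u \<le> v" "{u..v} \<subseteq> {0..1}" "{u..v} \<subseteq> ball t d" by auto
      have near: "\<gamma> s \<in> ball (\<gamma> t) r" if "s \<in> {u..v}" for s
        using d(2)[of s] that uv by (auto simp: dist_commute subset_iff)
      have "((\<lambda>t. vector_derivative \<gamma> (at t within {0..1}) *\<^sub>C g (\<gamma> t)) has_integral
          ((G \<circ> \<gamma>) v - (G \<circ> \<gamma>) u)) {u..v}"
      proof (rule fundamental_theorem_of_calculus_interior_strong[OF E(1) uv(1)])
        fix s assume s: "s \<in> {u<..<v} - E"
        then have s01: "s \<in> {0..1} - E" "s \<in> {u..v}" using uv(2) by (auto simp: subset_iff)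
        then have "(\<gamma> has_vector_derivative vector_derivative \<gamma> (at s)) (at s)"
          using E(2) unfolding C1_differentiable_on_eq by (simp add: vector_derivative_works)
        moreover from this have "vector_derivative \<gamma> (at s within {0..1}) = vector_derivative \<gamma> (at s)"
          using s01(1) by (intro vector_derivative_at_within_ivl) auto
        ultimately have "(\<gamma> has_derivative (\<lambda>h. h *\<^sub>R vector_derivative \<gamma> (at s within {0..1}))) (at s)"
          by (simp add: has_vector_derivative_def)
        from diff_chain_at[OF this G[OF near[OF s01(2)]]]
        have "((G \<circ> \<gamma>) has_derivative
            (\<lambda>h. (h *\<^sub>R vector_derivative \<gamma> (at s within {0..1})) *\<^sub>C g (\<gamma> s))) (at s)"
          by (simp add: comp_def)
        then show "((G \<circ> \<gamma>) has_vector_derivative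
            vector_derivative \<gamma> (at s within {0..1}) *\<^sub>C g (\<gamma> s)) (at s)"
          unfolding has_vector_derivative_def
          by (simp add: bounded_bilinear.scaleR_left[OF bounded_bilinear_scaleC])
      next
        have "continuous_on (ball (\<gamma> t) r) G"
          using G has_derivative_continuous by (intro continuous_at_imp_continuous_on) blast
        then show "continuous_on {u..v} (G \<circ> \<gamma>)"
          using near continuous_on_subset[OF cont\<gamma> uv(2)]
          by (intro continuous_on_compose) (auto elim!: continuous_on_subset)
      qed
      then show "(\<lambda>t. vector_derivative \<gamma> (at t within {0..1}) *\<^sub>C g (\<gamma> t)) integrable_on cbox u v"
        by (auto simp: integrable_on_def)
    qed
  qed
  then show ?thesis
    using integrable_on_little_subintervals[of 0 1] by (metis (no_types, lifting) box_real(2))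
qed

text \<open>Integrability of the vector-valued integrand lets the pairing pass under the integral.
  Statements about the calculus thereby become statements about scalar contour integrals.\<close>

lemma cinner_riesz_integral:
  fixes T :: "'a::chilbert \<Rightarrow> 'a"
  assumes T: "bounded_clinear T" and U: "open U" and f: "f holomorphic_on U"
    and \<Gamma>: "cycle_in (U - cspectrum T) \<Gamma>"
  shows "cinner (riesz_integral f T \<Gamma> x) y =
    1 / (2 * pi * \<i>) * (\<Sum>\<gamma>\<leftarrow>\<Gamma>. contour_integral \<gamma> (\<lambda>z. f z * cinner (cresolvent T z x) y))"
proof -
  let ?W = "U - cspectrum T"
  have W: "open ?W" using U compact_cspectrum[OF T] by (simp add: open_Diff compact_imp_closed)
  define g where "g z = f z *\<^sub>C cresolvent T z x" for z
  have fW: "f holomorphic_on ?W" using f by (rule holomorphic_on_subset) auto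
  have cont: "continuous_on ?W g"
    unfolding g_def using continuous_on_subset[OF continuous_on_cresolvent[OF T], of ?W]
    by (intro continuous_intros holomorphic_on_imp_continuous_on[OF fW]) auto
  have hol: "(\<lambda>z. cinner (g z) y) holomorphic_on ?W" for y
    unfolding g_def cinner_scaleC_left
    using holomorphic_on_subset[OF holomorphic_cinner_cresolvent[OF T], of ?W]
    by (intro holomorphic_intros fW) auto
  let ?\<phi> = "\<lambda>\<gamma> t. (vector_derivative \<gamma> (at t within {0..1}) * f (\<gamma> t)) *\<^sub>C cinverse (\<lambda>y. \<gamma> t *\<^sub>C y - T y) x"
  have one: "cinner (integral {0..1} (?\<phi> \<gamma>)) y =
      contour_integral \<gamma> (\<lambda>z. f z * cinner (cresolvent T z x) y)" if "\<gamma> \<in> set \<Gamma>" for \<gamma>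
  proof -
    have \<phi>: "?\<phi> \<gamma> = (\<lambda>t. vector_derivative \<gamma> (at t within {0..1}) *\<^sub>C g (\<gamma> t))"
      by (simp add: g_def cresolvent_def scaleC_scaleC)
    have "?\<phi> \<gamma> integrable_on {0..1}"
      unfolding \<phi> using that \<Gamma> by (intro contour_integrable_weakly_holomorphic[OF W cont hol]) (auto simp: cycle_in_def)
    then have "(?\<phi> \<gamma> has_integral integral {0..1} (?\<phi> \<gamma>)) {0..1}" by (rule integrable_integral)
    then have "((\<lambda>x. cinner x y) \<circ> ?\<phi> \<gamma> has_integral cinner (integral {0..1} (?\<phi> \<gamma>)) y) {0..1}"
      by (rule has_integral_linear[OF _ bounded_linear_cinner_left])
    then have "((\<lambda>z. f z * cinner (cresolvent T z x) y) has_contour_integral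
        cinner (integral {0..1} (?\<phi> \<gamma>)) y) \<gamma>"
      by (simp add: has_contour_integral_def comp_def cinner_scaleC_left cresolvent_def mult_ac)
    then show ?thesis by (simp add: contour_integral_unique)
  qed
  have "cinner (sum_list (map F xs)) y = (\<Sum>a\<leftarrow>xs. cinner (F a) y)" for F :: "(real \<Rightarrow> complex) \<Rightarrow> 'a" and xs
    by (induction xs) (auto simp: cinner_add_left)
  moreover have "(\<Sum>\<gamma>\<leftarrow>\<Gamma>. cinner (integral {0..1} (?\<phi> \<gamma>)) y) =
      (\<Sum>\<gamma>\<leftarrow>\<Gamma>. contour_integral \<gamma> (\<lambda>z. f z * cinner (cresolvent T z x) y))"
    by (intro arg_cong[of _ _ sum_list] map_cong refl one)
  ultimately show ?thesis
    unfolding riesz_integral_def cinner_scaleC_left by simp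
qed

text \<open>Independence of the cycle shows that the value satisfies the condition in
  \<open>fcalc\<close>; the given cycle makes it the only one, since with no admissible cycle every
  operator would qualify.\<close>

lemma fcalc_eq_riesz_integral:
  fixes T :: "'a::chilbert \<Rightarrow> 'a"
  assumes T: "bounded_clinear T" and U: "open U" and f: "f holomorphic_on U"
    and \<Gamma>: "admissible_cycles U (cspectrum T) \<Gamma>"
  shows "fcalc U f T = riesz_integral f T \<Gamma>"
  unfolding fcalc_def
proof (rule the_equality)
  have W: "closed (cspectrum T)" using compact_cspectrum[OF T] by (rule compact_imp_closed)
  show "\<forall>\<Gamma>'. admissible_cycles U (cspectrum T) \<Gamma>' \<longrightarrow> riesz_integral f T \<Gamma> = riesz_integral f T \<Gamma>'"
  proof (intro allI impI ext cinner_eqI)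
    fix \<Gamma>' x y assume \<Gamma>': "admissible_cycles U (cspectrum T) \<Gamma>'"
    have "(\<lambda>z. f z * cinner (cresolvent T z x) y) holomorphic_on U - cspectrum T"
      by (intro holomorphic_intros holomorphic_on_subset[OF f]
          holomorphic_on_subset[OF holomorphic_cinner_cresolvent[OF T]]) auto
    from admissible_cycles_independent[OF U W \<Gamma> \<Gamma>' this]
    show "cinner (riesz_integral f T \<Gamma> x) y = cinner (riesz_integral f T \<Gamma>' x) y"
      using cinner_riesz_integral[OF T U f] \<Gamma> \<Gamma>' by (simp add: admissible_cycles_in)
  qed
  show "F = riesz_integral f T \<Gamma>"
    if "\<forall>\<Gamma>'. admissible_cycles U (cspectrum T) \<Gamma>' \<longrightarrow> F = riesz_integral f T \<Gamma>'" for F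
    using that \<Gamma> by blast
qed

text \<open>The cycle may surround a set larger than the spectrum, which leaves room for a common
  cycle for two operators.\<close>

lemma cinner_fcalc:
  fixes T :: "'a::chilbert \<Rightarrow> 'a"
  assumes "bounded_clinear T" "open U" "f holomorphic_on U"
    and \<Gamma>: "admissible_cycles U S \<Gamma>" and S: "cspectrum T \<subseteq> S"
  shows "cinner (fcalc U f T x) y =
    1 / (2 * pi * \<i>) * (\<Sum>\<gamma>\<leftarrow>\<Gamma>. contour_integral \<gamma> (\<lambda>z. f z * cinner (cresolvent T z x) y))"
  using fcalc_eq_riesz_integral[OF assms(1-3)] cinner_riesz_integral[OF assms(1-3)]
    admissible_cycles_subset[OF \<Gamma> S] admissible_cycles_in by metis

section \<open>Compressions and Krein spaces\<close>

lemma bounded_clinear_fst: "bounded_clinear fst"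
  by (rule bounded_clinear_intro[where K = 1]) (auto simp: scaleC_prod_def norm_fst_le)

lemma bounded_clinear_snd: "bounded_clinear snd"
  by (rule bounded_clinear_intro[where K = 1]) (auto simp: scaleC_prod_def norm_snd_le)

lemma bounded_clinear_Pair:
  assumes S: "bounded_clinear S" and T: "bounded_clinear T"
  shows "bounded_clinear (\<lambda>x. (S x, T x))"
proof -
  obtain K where K: "K > 0" "\<And>x. norm (S x) \<le> norm x * K"
    by (rule bounded_clinear_pos[OF S]) (rule that)
  obtain L where L: "L > 0" "\<And>x. norm (T x) \<le> norm x * L"
    by (rule bounded_clinear_pos[OF T]) (rule that)
  have "norm (S x, T x) \<le> norm x * (K + L)" for x
    using norm_Pair_le[of "S x" "T x"] K(2)[of x] L(2)[of x] by (simp add: distrib_left)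
  then show ?thesis
    by (rule bounded_clinear_intro[rotated 2])
      (simp_all add: bounded_clinearD(1,2)[OF S] bounded_clinearD(1,2)[OF T] scaleC_prod_def)
qed

text \<open>Since \<open>R \<circ> R'\<close> is the identity, \<open>R' \<circ> R\<close> is a
  projection onto the range of \<open>R'\<close>. There the compression acts as a copy of
  \<open>A\<close>, and on the kernel of \<open>R\<close> it is 0, with resolvent
  \<open>1 / z\<close>.\<close>

lemma coisometric_compression:
  fixes R :: "'k::chilbert \<Rightarrow> 'h::chilbert" and A :: "'h \<Rightarrow> 'h"
  assumes R: "bounded_clinear R" and R': "bounded_clinear R'" and A: "bounded_clinear A"
    and RR': "\<And>x. R (R' x) = x"
    and z: "z \<notin> cspectrum A" "z \<noteq> 0"
  shows "z \<notin> cspectrum (R' \<circ> A \<circ> R)"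
    and "cresolvent (R' \<circ> A \<circ> R) z x = (1 / z) *\<^sub>C (x - R' (R x)) + R' (cresolvent A z (R x))"
proof -
  note lin = bounded_clinearD[OF R] bounded_clinearD[OF R'] bounded_clinearD[OF A]
  note res = cresolvent[OF z(1)]
  note resl = bounded_clinearD[OF res(1)]
  define S where "S x = (1 / z) *\<^sub>C (x - R' (R x)) + R' (cresolvent A z (R x))" for x
  have B: "bounded_clinear (R' \<circ> A \<circ> R)"
    by (intro bounded_clinear_compose R R' A)
  have bS: "bounded_clinear S"
    unfolding S_def
    using bounded_clinear_compose[OF bounded_clinear_compose[OF R' res(1)] R] bounded_clinear_compose[OF R' R]
    by (intro bounded_clinear_add bounded_clinear_scaleC bounded_clinear_diff bounded_clinear_ident)
      (simp_all add: comp_def)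
  have RS: "R (S x) = cresolvent A z (R x)" for x
    by (simp add: S_def lin RR')
  have 1: "z *\<^sub>C S x - (R' \<circ> A \<circ> R) (S x) = x" for x
  proof -
    have "z *\<^sub>C S x - (R' \<circ> A \<circ> R) (S x) =
        x - R' (R x) + R' (z *\<^sub>C cresolvent A z (R x) - A (cresolvent A z (R x)))"
      unfolding comp_apply RS using z(2)
      by (simp add: S_def scaleC_add_right scaleC_scaleC scaleC_one lin)
    then show ?thesis by (simp add: res)
  qed
  have 2: "S (z *\<^sub>C x - (R' \<circ> A \<circ> R) x) = x" for x
  proof -
    have "R (z *\<^sub>C x - (R' \<circ> A \<circ> R) x) = z *\<^sub>C R x - A (R x)"
      by (simp add: lin RR')
    moreover have "z *\<^sub>C x - (R' \<circ> A \<circ> R) x - R' (z *\<^sub>C R x - A (R x)) = z *\<^sub>C (x - R' (R x))"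
      by (simp add: lin scaleC_diff_right)
    ultimately show ?thesis
      unfolding S_def using z(2) by (simp only: res scaleC_scaleC) (simp add: scaleC_one)
  qed
  show "z \<notin> cspectrum (R' \<circ> A \<circ> R)"
    and "cresolvent (R' \<circ> A \<circ> R) z x = (1 / z) *\<^sub>C (x - R' (R x)) + R' (cresolvent A z (R x))"
    using cresolvent_unique[OF B bS 2 1] S_def by (auto simp: comp_def)
qed

text \<open>The resolvent of \<open>R' A R\<close> is that of \<open>A\<close> up to the term \<open>(I - R' R) / z\<close>, which contributes
  \<open>f 0 (I - R' R) = 0\<close>.\<close>
lemma fcalc_coisometric_compression:
  fixes R :: "'k::chilbert \<Rightarrow> 'h::chilbert" and A :: "'h \<Rightarrow> 'h"
  assumes R: "bounded_clinear R" and R': "bounded_clinear R'" and A: "bounded_clinear A"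
    and RR': "\<And>x. R (R' x) = x"
    and U: "open U" "0 \<in> U" "cspectrum A \<subseteq> U" and f: "f holomorphic_on U" "f 0 = 0"
  shows "fcalc U f (R' \<circ> A \<circ> R) x = R' (fcalc U f A (R x))"
proof (rule cinner_eqI)
  fix y
  let ?B = "R' \<circ> A \<circ> R"
  \<comment> \<open>The compression may acquire the spectral point 0, so the common cycle surrounds
    0 as well.\<close>
  define S where "S = insert 0 (cspectrum A)"
  have SB: "cspectrum ?B \<subseteq> S" and SA: "cspectrum A \<subseteq> S"
    using coisometric_compression(1)[OF R R' A RR'] by (auto simp: S_def)
  have "compact S" using compact_cspectrum[OF A] by (simp add: S_def)
  have "S \<subseteq> U" using U by (simp add: S_def)
  obtain \<Gamma> where \<Gamma>: "admissible_cycles U S \<Gamma>"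
    using admissible_cycles_exist[OF \<open>compact S\<close> U(1) \<open>S \<subseteq> U\<close>] .
  note cyc = admissible_cycles_in[OF \<Gamma>]
  have B: "bounded_clinear ?B" by (intro bounded_clinear_compose R R' A)
  \<comment> \<open>Because \<open>f 0 = 0\<close>, this is \<open>f z / z\<close> with the
    singularity at 0 removed, in the form used by \<open>pole_lemma_open\<close>. It is the
    coefficient of the projection term in the resolvent.\<close>
  define k where "k z = (if z = 0 then deriv f 0 else (f z - f 0) / (z - 0))" for z
  have k: "k holomorphic_on U" unfolding k_def by (rule pole_lemma_open[OF f(1) U(1)])
  have k0: "(\<Sum>\<gamma>\<leftarrow>\<Gamma>. contour_integral \<gamma> k) = 0" by (rule admissible_cycles_zero[OF U(1) \<Gamma> k])
  define c where "c = cinner (x - R' (R x)) y"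
  define g where "g z = f z * cinner (cresolvent A z (R x)) (cadj R' y)" for z
  have US: "open (U - S)" using U(1) \<open>compact S\<close> by (simp add: open_Diff compact_imp_closed)
  have gS: "g holomorphic_on U - S"
    unfolding g_def using SA
    by (intro holomorphic_intros holomorphic_on_subset[OF f(1)]
        holomorphic_on_subset[OF holomorphic_cinner_cresolvent[OF A]]) auto
  have "(\<Sum>\<gamma>\<leftarrow>\<Gamma>. contour_integral \<gamma> (\<lambda>z. f z * cinner (cresolvent ?B z x) y)) =
      (\<Sum>\<gamma>\<leftarrow>\<Gamma>. c * contour_integral \<gamma> k + contour_integral \<gamma> g)"
  proof (intro arg_cong[of _ _ sum_list] map_cong refl)
    fix \<gamma> assume \<gamma>: "\<gamma> \<in> set \<Gamma>"
    then have vp: "valid_path \<gamma>" and im: "path_image \<gamma> \<subseteq> U - S" using cyc by (auto simp: cycle_in_def)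
    have int: "k contour_integrable_on \<gamma>" "g contour_integrable_on \<gamma>"
      using contour_integrable_holomorphic_simple[OF holomorphic_on_subset[OF k] US vp im]
        contour_integrable_holomorphic_simple[OF gS US vp im] by auto
    have "contour_integral \<gamma> (\<lambda>z. f z * cinner (cresolvent ?B z x) y) = contour_integral \<gamma> (\<lambda>z. c * k z + g z)"
    proof (rule contour_integral_eq)
      fix z assume "z \<in> path_image \<gamma>"
      then have z: "z \<notin> cspectrum A" "z \<noteq> 0" using im by (auto simp: S_def)
      show "f z * cinner (cresolvent ?B z x) y = c * k z + g z"
        unfolding coisometric_compression(2)[OF R R' A RR' z] cinner_add_left cinner_scaleC_left
          cinner_cadj[OF R'] using z(2) by (simp add: c_def k_def g_def f(2) distrib_left)
    qed
    then show "contour_integral \<gamma> (\<lambda>z. f z * cinner (cresolvent ?B z x) y) =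
        c * contour_integral \<gamma> k + contour_integral \<gamma> g"
      using int by (simp only: contour_integral_add contour_integrable_lmul contour_integral_lmul)
  qed
  also have "\<dots> = (\<Sum>\<gamma>\<leftarrow>\<Gamma>. contour_integral \<gamma> g)"
    by (simp add: sum_list_addf sum_list_const_mult k0)
  finally have "cinner (fcalc U f ?B x) y = cinner (fcalc U f A (R x)) (cadj R' y)"
    unfolding cinner_fcalc[OF B U(1) f(1) \<Gamma> SB] cinner_fcalc[OF A U(1) f(1) \<Gamma> SA] g_def by simp
  then show "cinner (fcalc U f ?B x) y = cinner (R' (fcalc U f A (R x))) y"
    by (simp add: cinner_cadj[OF R'])
qed

lemma bounded_clinear_diagonal:
  assumes "bounded_clinear T1" "bounded_clinear T2"
  shows "bounded_clinear (\<lambda>v. (T1 (fst v), T2 (snd v)))"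
  using bounded_clinear_Pair[OF bounded_clinear_compose[OF assms(1) bounded_clinear_fst]
      bounded_clinear_compose[OF assms(2) bounded_clinear_snd]] by (simp add: comp_def)

lemma cresolvent_diagonal:
  fixes T1 :: "'a::chilbert \<Rightarrow> 'a" and T2 :: "'b::chilbert \<Rightarrow> 'b"
  assumes T: "bounded_clinear T1" "bounded_clinear T2"
    and z: "z \<notin> cspectrum T1" "z \<notin> cspectrum T2"
  shows "z \<notin> cspectrum (\<lambda>v. (T1 (fst v), T2 (snd v)))"
    and "cresolvent (\<lambda>v. (T1 (fst v), T2 (snd v))) z v = (cresolvent T1 z (fst v), cresolvent T2 z (snd v))"
proof -
  let ?S = "\<lambda>v. (cresolvent T1 z (fst v), cresolvent T2 z (snd v))"
  note r1 = cresolvent[OF z(1)] and r2 = cresolvent[OF z(2)]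
  have bS: "bounded_clinear ?S" by (rule bounded_clinear_diagonal[OF r1(1) r2(1)])
  have "?S (z *\<^sub>C v - (T1 (fst v), T2 (snd v))) = v"
    "z *\<^sub>C ?S v - (T1 (fst (?S v)), T2 (snd (?S v))) = v" for v
    by (simp_all add: scaleC_prod_def r1 r2)
  note * = cresolvent_unique[OF bounded_clinear_diagonal[OF T] bS this]
  show "z \<notin> cspectrum (\<lambda>v. (T1 (fst v), T2 (snd v)))"
    and "cresolvent (\<lambda>v. (T1 (fst v), T2 (snd v))) z v = ?S v"
    using * by auto
qed

text \<open>On a cycle around both spectra the resolvent is diagonal, so the calculus acts
  entrywise. The first entry is the one seen by test vectors with second component 0.\<close>

lemma cinner_fcalc_diagonal:
  fixes T1 :: "'a::chilbert \<Rightarrow> 'a" and T2 :: "'b::chilbert \<Rightarrow> 'b"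
  assumes T: "bounded_clinear T1" "bounded_clinear T2"
    and U: "open U" "cspectrum T1 \<subseteq> U" "cspectrum T2 \<subseteq> U" and f: "f holomorphic_on U"
  shows "cinner (fcalc U f (\<lambda>v. (T1 (fst v), T2 (snd v))) (x, 0)) (y, 0) = cinner (fcalc U f T1 x) y"
proof -
  let ?T = "\<lambda>v. (T1 (fst v), T2 (snd v))"
  define S where "S = cspectrum T1 \<union> cspectrum T2"
  have S: "cspectrum ?T \<subseteq> S" "cspectrum T1 \<subseteq> S" "compact S" "S \<subseteq> U"
    using cresolvent_diagonal(1)[OF T] U(2,3) compact_cspectrum[OF T(1)] compact_cspectrum[OF T(2)]
    by (auto simp: S_def)
  obtain \<Gamma> where \<Gamma>: "admissible_cycles U S \<Gamma>"
    using admissible_cycles_exist[OF S(3) U(1) S(4)] .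
  have "(\<Sum>\<gamma>\<leftarrow>\<Gamma>. contour_integral \<gamma> (\<lambda>z. f z * cinner (cresolvent ?T z (x, 0)) (y, 0))) =
      (\<Sum>\<gamma>\<leftarrow>\<Gamma>. contour_integral \<gamma> (\<lambda>z. f z * cinner (cresolvent T1 z x) y))"
  proof (intro arg_cong[of _ _ sum_list] map_cong refl contour_integral_eq)
    fix \<gamma> z assume "\<gamma> \<in> set \<Gamma>" "z \<in> path_image \<gamma>"
    then have "z \<notin> S" using admissible_cycles_in[OF \<Gamma>] by (auto simp: cycle_in_def)
    then have z: "z \<notin> cspectrum T1" "z \<notin> cspectrum T2" by (auto simp: S_def)
    show "f z * cinner (cresolvent ?T z (x, 0)) (y, 0) = f z * cinner (cresolvent T1 z x) y"
      by (simp add: cresolvent_diagonal(2)[OF T z] cinner_prod_def)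
  qed
  then show ?thesis
    unfolding cinner_fcalc[OF bounded_clinear_diagonal[OF T] U(1) f \<Gamma> S(1)]
      cinner_fcalc[OF T(1) U(1) f \<Gamma> S(2)] by simp
qed

section \<open>Fundamental symmetries and Krein adjoints\<close>

lemma sa_involutionD:
  assumes "sa_involution J"
  shows "bounded_clinear J" "J (J x) = x" "cinner (J x) y = cinner x (J y)"
proof -
  show J: "bounded_clinear J" using assms by (simp add: sa_involution_def)
  show "J (J x) = x" using assms unfolding sa_involution_def by (metis comp_apply id_apply)
  show "cinner (J x) y = cinner x (J y)"
    using cinner_cadj[OF J] assms by (simp add: sa_involution_def)
qed

lemma sa_involution_diagonal:
  assumes J: "sa_involution J" and K: "sa_involution K"
  shows "sa_involution (\<lambda>v. (J (fst v), K (snd v)))"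
  unfolding sa_involution_def
proof (intro conjI)
  note J' = sa_involutionD[OF J] and K' = sa_involutionD[OF K]
  show "bounded_clinear (\<lambda>v. (J (fst v), K (snd v)))"
    by (rule bounded_clinear_diagonal[OF J'(1) K'(1)])
  show "cadj (\<lambda>v. (J (fst v), K (snd v))) = (\<lambda>v. (J (fst v), K (snd v)))"
    by (rule cadj_unique) (simp add: cinner_prod_def J'(3) K'(3))
  show "(\<lambda>v. (J (fst v), K (snd v))) \<circ> (\<lambda>v. (J (fst v), K (snd v))) = id"
    by (simp add: fun_eq_iff J'(2) K'(2))
qed

text \<open>The sum inherits nontriviality from \<open>J\<close>, so the auxiliary space may be a
  Hilbert space.\<close>

lemma krein_space_diagonal:
  assumes J: "krein_space J" and K: "sa_involution K"
  shows "krein_space (\<lambda>v. (J (fst v), K (snd v)))"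
proof -
  obtain x y where "J x \<noteq> x" "J y \<noteq> - y"
    using J unfolding krein_space_def by (metis eq_id_iff ext)
  then have "(\<lambda>v. (J (fst v), K (snd v))) (x, 0) \<noteq> id (x, 0)"
    "(\<lambda>v. (J (fst v), K (snd v))) (y, 0) \<noteq> - (y, 0)" by auto
  then have "(\<lambda>v. (J (fst v), K (snd v))) \<noteq> id" "(\<lambda>v. (J (fst v), K (snd v))) \<noteq> uminus"
    by metis+
  moreover have "sa_involution J" using J by (simp add: krein_space_def)
  ultimately show ?thesis
    using sa_involution_diagonal[OF _ K, of J] by (simp add: krein_space_def)
qed

lemma bounded_clinear_ksharp:
  "sa_involution J1 \<Longrightarrow> sa_involution J2 \<Longrightarrow> bounded_clinear T \<Longrightarrow> bounded_clinear (ksharp J1 J2 T)"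
  unfolding ksharp_def by (intro bounded_clinear_compose bounded_clinear_cadj sa_involutionD)

lemma cinner_ksharp:
  assumes J: "sa_involution J1" and T: "bounded_clinear T"
  shows "cinner (J1 (ksharp J1 J2 T y)) x = cinner (J2 y) (T x)"
  by (simp add: ksharp_def sa_involutionD[OF J] cinner_cadj'[OF T])

text \<open>Turns the defect identity for \<open>C\<^sup>\<sharp>\<close> into one that involves
  \<open>C\<close> itself.\<close>

lemma ksharp_ksharp:
  assumes J1: "sa_involution J1" and J2: "sa_involution J2" and T: "bounded_clinear T"
  shows "ksharp J2 J1 (ksharp J1 J2 T) = T"
proof -
  have "cadj (ksharp J1 J2 T) = J2 \<circ> T \<circ> J1"
    by (rule cadj_unique)
      (simp add: ksharp_def sa_involutionD(3)[OF J1] sa_involutionD(3)[OF J2] cinner_cadj'[OF T])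
  then show ?thesis
    by (simp add: ksharp_def fun_eq_iff sa_involutionD(2)[OF J1] sa_involutionD(2)[OF J2])
qed

text \<open>The two patterns in which cross terms cancel, one for each component of the averaged
  operator.\<close>

lemma midpoint_plus_minus:
  fixes p q :: "'a::real_vector"
  shows "(1/2) *\<^sub>R (p + q) + (1/2) *\<^sub>R (p - q) = p" "(1/2) *\<^sub>R (p + q) + (1/2) *\<^sub>R (q - p) = q"
  by (simp_all flip: scaleR_add_right)

theorem theorem2p7:
  fixes U :: "complex set" and f :: "complex \<Rightarrow> complex"
    and J :: "'a::chilbert \<Rightarrow> 'a" and A C :: "'a \<Rightarrow> 'a"
    and Jt :: "'b::chilbert \<Rightarrow> 'b" and D :: "'b \<Rightarrow> 'a"
  assumes U_open: "open U"
    and U_sym: "\<forall>z\<in>U. cnj z \<in> U"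
    and U_real: "is_interval {x::real. complex_of_real x \<in> U}"
    and f_conv: "krein_op_convex TYPE('a) U f"
    and f_conv2: "krein_op_convex TYPE('a \<times> 'b) U f"
    and zero_in: "0 \<in> U"
    and f0: "f 0 = 0"
    and J: "krein_space J"
    and A: "kpositive J A"
    and C_inv: "cinvertible C"
    and C_contr: "kcontraction J C"
    and D: "defect_operator Jt J J (ksharp J J C) D"
    and spA: "cspectrum A \<subseteq> U"
    and spCAC: "cspectrum (ksharp J J C \<circ> A \<circ> C) \<subseteq> U"
    and spDAD: "cspectrum (ksharp Jt J D \<circ> A \<circ> D) \<subseteq> U"
  shows "kle J (fcalc U f (ksharp J J C \<circ> A \<circ> C)) (ksharp J J C \<circ> fcalc U f A \<circ> C)"
proof -
  have sJ: "sa_involution J" using J by (simp add: krein_space_def)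
  have sJt: "sa_involution Jt" and bD: "bounded_clinear D" using D by (auto simp: defect_operator_def)
  have bC: "bounded_clinear C" using C_inv by (simp add: cinvertible_def)
  have bA: "bounded_clinear A" using A by (simp add: kpositive_def)
  have f: "f holomorphic_on U" using f_conv2 by (simp add: krein_op_convex_def analytic_imp_holomorphic)
  let ?C = "ksharp J J C" and ?D = "ksharp Jt J D"
  note bC' = bounded_clinear_ksharp[OF sJ sJ bC] and bD' = bounded_clinear_ksharp[OF sJt sJ bD]
  note lin = bounded_clinearD[OF bA] bounded_clinearD[OF bC] bounded_clinearD[OF bD]
    bounded_clinearD[OF bC'] bounded_clinearD[OF bD']
  have defect: "C (?C x) + D (?D x) = x" for x
    using D ksharp_ksharp[OF sJ sJ bC] unfolding defect_operator_def fun_eq_iff comp_apply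
    by (metis add.commute diff_add_cancel)
  define J' where "J' = (\<lambda>v. (J (fst v), Jt (snd v)))"
  have kJ': "krein_space J'" unfolding J'_def by (rule krein_space_diagonal[OF J sJt])
  then have sJ': "sa_involution J'" by (simp add: krein_space_def)
  note J'D = sa_involutionD[OF sJ']
  \<comment> \<open>The sign is a complex scalar \<open>s\<close>: \<open>s * s = 1\<close> makes
    \<open>R s \<circ> R' s\<close> the identity, by the defect identity, and
    \<open>cnj s = s\<close> makes \<open>R' s\<close> the Krein adjoint of
    \<open>R s\<close>.\<close>
  define R where "R s v = C (fst v) + s *\<^sub>C D (snd v)" for s and v :: "'a \<times> 'b"
  define R' where "R' s x = (?C x, s *\<^sub>C ?D x)" for s x
  define B where "B s = R' s \<circ> A \<circ> R s" for s
  define T where "T = (\<lambda>v. ((?C \<circ> A \<circ> C) (fst v), (?D \<circ> A \<circ> D) (snd v)))"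
  have bR: "bounded_clinear (R s)" for s
    unfolding R_def
    using bounded_clinear_compose[OF bC bounded_clinear_fst] bounded_clinear_compose[OF bD bounded_clinear_snd]
    by (intro bounded_clinear_add bounded_clinear_scaleC) (simp_all add: comp_def)
  have bR': "bounded_clinear (R' s)" for s
    unfolding R'_def by (intro bounded_clinear_Pair bounded_clinear_scaleC bC' bD')
  have bB: "bounded_clinear (B s)" for s
    unfolding B_def by (intro bounded_clinear_compose bR bR' bA)
  have RR': "R s (R' s x) = x" if "s * s = 1" for s x
    by (simp add: R_def R'_def lin scaleC_scaleC that scaleC_one defect)
  have spB: "cspectrum (B s) \<subseteq> U" if "s * s = 1" for s
    using coisometric_compression(1)[OF bR bR' bA RR'[OF that]] spA zero_in unfolding B_def by blast
  have fB: "fcalc U f (B s) v = R' s (fcalc U f A (R s v))" if "s * s = 1" for s v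
    unfolding B_def by (rule fcalc_coisometric_compression[OF bR bR' bA RR'[OF that] U_open zero_in spA f f0])
  have J'R': "cinner (J' (R' s u)) v = cinner (J u) (R s v)" if "cnj s = s" for s u v
    using that by (simp add: J'_def R'_def R_def cinner_prod_def cinner_add_right cinner_scaleC_left
        cinner_scaleC_right bounded_clinearD(2)[OF sa_involutionD(1)[OF sJt]]
        cinner_ksharp[OF sJ bC] cinner_ksharp[OF sJt bD])
  \<comment> \<open>The indefinite form of \<open>B s\<close> at \<open>v\<close> is that of
    \<open>A\<close> at \<open>R s v\<close>.\<close>
  have posB: "kpositive J' (B s)" if "cnj s = s" for s
    using A bB bounded_clinearD(3)[OF sa_involutionD(1)[OF sJ]] bounded_clinearD(3)[OF J'D(1)]
    by (simp add: kpositive_def kle_def B_def J'R'[OF that])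
  have avg: "(\<lambda>v. (1 - 1/2) *\<^sub>R B 1 v + (1/2) *\<^sub>R B (-1) v) = T"
  proof
    fix v :: "'a \<times> 'b"
    show "(1 - 1/2) *\<^sub>R B 1 v + (1/2) *\<^sub>R B (-1) v = T v"
      by (simp add: B_def R'_def R_def T_def lin scaleC_one scaleC_minus_left midpoint_plus_minus)
  qed
  have bCAC: "bounded_clinear (?C \<circ> A \<circ> C)" and bDAD: "bounded_clinear (?D \<circ> A \<circ> D)"
    by (intro bounded_clinear_compose bA bC bD bC' bD')+
  have spT: "cspectrum T \<subseteq> U"
    using cresolvent_diagonal(1)[OF bCAC bDAD] spCAC spDAD unfolding T_def by blast
  have conv: "kle J' (fcalc U f T) (\<lambda>v. (1 - 1/2) *\<^sub>R fcalc U f (B 1) v + (1/2) *\<^sub>R fcalc U f (B (-1)) v)"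
    unfolding avg[symmetric]
  proof (rule f_conv2[unfolded krein_op_convex_def, THEN conjunct2, THEN conjunct2, rule_format,
        of J' "B 1" "B (-1)" "1/2"])
    show "cspectrum (\<lambda>v. (1 - 1/2) *\<^sub>R B 1 v + (1/2) *\<^sub>R B (-1) v) \<subseteq> U"
      unfolding avg by (rule spT)
  qed (use kJ' posB spB in auto)
  show ?thesis
    unfolding kle_def
  proof
    fix x
    let ?v = "(x, 0) :: 'a \<times> 'b"
    let ?q = "cinner (J (fcalc U f A (C x))) (C x)"
    \<comment> \<open>The sign disappears on \<open>(x, 0)\<close>, so both terms of the convex
      combination contribute the same value \<open>?q\<close>.\<close>
    have Rv: "R s ?v = C x" for s by (simp add: R_def lin)
    have "cinner (J' (fcalc U f T ?v)) ?v = cinner (fcalc U f T ?v) (J x, 0)"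
      unfolding J'D(3) by (simp add: J'_def bounded_clinearD(3)[OF sa_involutionD(1)[OF sJt]])
    also have "\<dots> = cinner (fcalc U f (?C \<circ> A \<circ> C) x) (J x)"
      unfolding T_def by (rule cinner_fcalc_diagonal[OF bCAC bDAD U_open spCAC spDAD f])
    finally have lhs: "cinner (J' (fcalc U f T ?v)) ?v = cinner (J (fcalc U f (?C \<circ> A \<circ> C) x)) x"
      by (simp add: sa_involutionD(3)[OF sJ])
    have "cinner (J' ((1 - 1/2) *\<^sub>R fcalc U f (B 1) ?v + (1/2) *\<^sub>R fcalc U f (B (-1)) ?v)) ?v = ?q"
      by (simp add: scaleR_scaleC[where 'a = "'a \<times> 'b"] bounded_clinearD(1,2)[OF J'D(1)] cinner_add_left
          cinner_scaleC_left fB J'R' Rv)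
    moreover have "cinner (J ((?C \<circ> fcalc U f A \<circ> C) x)) x = ?q"
      by (simp add: cinner_ksharp[OF sJ bC])
    ultimately show "Re (cinner (J (fcalc U f (?C \<circ> A \<circ> C) x)) x) \<le> Re (cinner (J ((?C \<circ> fcalc U f A \<circ> C) x)) x) \<and>
        Im (cinner (J (fcalc U f (?C \<circ> A \<circ> C) x)) x) = Im (cinner (J ((?C \<circ> fcalc U f A \<circ> C) x)) x)"
      using conv[unfolded kle_def, rule_format, of ?v] lhs by simp
  qed
qed

end
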